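(* Let $V,Y$ be real Banach spaces, $U\subset V$ open, $m\in\mathbb{N}$, $\mathcal{E}\colon U\to\mathbb{R}$, $\mathcal{G}\colon U\to\mathbb{R}^m$ analytic, $\bar u\in U$, and assume: (i) $V\hookrightarrow Y$ continuously and densely; (ii) $\mathcal{E}'(u)\in Y^\ast$ for all $u\in U$ and $u\mapsto\mathcal{E}'(u)$ is analytic $U\to Y^\ast$; (iii) $\mathcal{E}''(\bar u)\colon V\to Y^\ast$ is Fredholm of index zero; (iv) each $\mathcal{G}'(u)$ extends to $\overline{\mathcal{G}'(u)}\in\mathcal{L}(Y,\mathbb{R}^m)$ and $u\mapsto\overline{\mathcal{G}'(u)}$ is analytic $U\to\mathcal{L}(Y,\mathbb{R}^m)$; (v) $(\overline{\mathcal{G}'})'(\bar u)\colon V\to\mathcal{L}(Y,\mathbb{R}^m)$ is compact; (vi) $\mathcal{G}(\bar u)=0$ and $\mathcal{G}'(\bar u)$ is surjective. Let $V_0=\ker\mathcal{G}'(\bar u)$, $V_1$ a closed complement, $\Omega_0\subset V_0$, $\Omega_1\subset V_1$ open with $\bar u\in\Omega=\Omega_0+\Omega_1\subset U$, $\psi\colon\Omega_0\to V$ analytic with $\psi(\Omega_0)\subset\Omega_1$, $\{u\in\Omega\mid\mathcal{G}(u)=0\}=\{\omega+\psi(\omega)\mid\omega\in\Omega_0\}$, and $\mathcal{G}'(u)|_{V_1}$ an isomorphism onto $\mathbb{R}^m$ for $u\in\Omega$. Let $\varphi(\omega)=\omega+\psi(\omega)$, $\mathcal{F}=\mathcal{E}\circ\varphi$,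 and regard $\omega\mapsto\mathcal{F}'(\omega)$ as an (analytic) map $\Omega_0\to\overline{V_0}^\ast$, where $\overline{V_0}$ is the $Y$-closure of $V_0$ and $\mathcal{F}'(\omega)$ is identified with its continuous extension to $\overline{V_0}$. Then for $\bar\omega\in\Omega_0$ with $\varphi(\bar\omega)=\bar u$, the derivative $\mathcal{F}''(\bar\omega)\colon V_0\to\overline{V_0}^\ast$ is a Fredholm operator of index zero.
   Context: Analytic means locally given by norm-convergent power series of continuous multilinear maps. $\overline{V_0}^\ast$ is the dual of $\overline{V_0}$ with the $Y$-norm; $\mathcal{E}''(\bar u)$ is the Fréchet derivative at $\bar u$ of $u\mapsto\mathcal{E}'(u)\in Y^\ast$. *)

theory Defs
  imports "HOL-Analysis.Analysis"
begin

definition multilin_bdd ::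
  "'a::real_normed_vector set \<Rightarrow> nat \<Rightarrow> ('a list \<Rightarrow> 'b::real_normed_vector) \<Rightarrow> real \<Rightarrow> bool" where
  "multilin_bdd S k A M \<longleftrightarrow>
     (\<forall>xs. length xs = k \<and> set xs \<subseteq> S \<longrightarrow>
        (\<forall>i<k. \<forall>a\<in>S. \<forall>b\<in>S. \<forall>c::real.
            A (xs[i := a + b]) = A (xs[i := a]) + A (xs[i := b]) \<and>
            A (xs[i := c *\<^sub>R a]) = c *\<^sub>R A (xs[i := a])) \<and>
        norm (A xs) \<le> M * prod_list (map norm xs))"

text \<open>Analyticity on D, a (relatively) open subset of the closed subspace S: locally given by
  a norm-convergent power series of continuous multilinear maps (on S).\<close>
definition analytic_sub ::
  "'a::real_normed_vector set \<Rightarrow> 'a set \<Rightarrow> ('a \<Rightarrow> 'b::real_normed_vector) \<Rightarrow> bool" where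
  "analytic_sub S D f \<longleftrightarrow>
     (\<forall>x\<in>D. \<exists>r>0. \<exists>(A::nat \<Rightarrow> 'a list \<Rightarrow> 'b) (M::nat \<Rightarrow> real).
        (\<forall>k. M k \<ge> 0 \<and> multilin_bdd S k (A k) (M k)) \<and>
        summable (\<lambda>k. M k * r ^ k) \<and>
        (\<forall>h\<in>S. norm h < r \<longrightarrow> x + h \<in> D \<and> (\<lambda>k. A k (replicate k h)) sums f (x + h)))"

definition fredholm0 :: "('a::real_normed_vector \<Rightarrow> 'b::real_normed_vector) \<Rightarrow> bool" where
  "fredholm0 T \<longleftrightarrow> bounded_linear T \<and> closed (range T) \<and>
     (\<exists>B. finite B \<and> independent B \<and> span B = {x. T x = 0} \<and>
        (\<exists>b::nat \<Rightarrow> 'b.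
           (\<forall>c. (\<Sum>i<card B. c i *\<^sub>R b i) \<in> range T \<longrightarrow> (\<forall>i<card B. c i = 0)) \<and>
           (\<forall>y. \<exists>x c. y = T x + (\<Sum>i<card B. c i *\<^sub>R b i))))"

text \<open>The dual of a linear subspace S of Y (with the norm of Y): bounded linear functionals
  on S, represented canonically as functions on Y vanishing outside S.\<close>
definition dual_sp :: "'y::real_normed_vector set \<Rightarrow> ('y \<Rightarrow> real) set" where
  "dual_sp S = {f. (\<forall>x\<in>S. \<forall>y\<in>S. \<forall>c. f (x + y) = f x + f y \<and> f (c *\<^sub>R x) = c * f x) \<and>
                   (\<exists>K. \<forall>y\<in>S. \<bar>f y\<bar> \<le> K * norm y) \<and> (\<forall>y. y \<notin> S \<longrightarrow> f y = 0)}"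

definition dual_norm :: "'y::real_normed_vector set \<Rightarrow> ('y \<Rightarrow> real) \<Rightarrow> real" where
  "dual_norm S f = (SUP y\<in>{y\<in>S. norm y \<le> 1}. \<bar>f y\<bar>)"

definition fredholm0_dual ::
  "'a::real_normed_vector set \<Rightarrow> 'y::real_normed_vector set \<Rightarrow> ('a \<Rightarrow> 'y \<Rightarrow> real) \<Rightarrow> bool" where
  "fredholm0_dual X S T \<longleftrightarrow>
     (\<forall>x\<in>X. \<forall>x'\<in>X. \<forall>c. T (x + x') = (\<lambda>y. T x y + T x' y) \<and> T (c *\<^sub>R x) = (\<lambda>y. c * T x y)) \<and>
     (\<forall>x\<in>X. T x \<in> dual_sp S) \<and>
     (\<exists>K. \<forall>x\<in>X. dual_norm S (T x) \<le> K * norm x) \<and>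
     (\<forall>g s. (\<forall>n. s n \<in> T ` X) \<longrightarrow> g \<in> dual_sp S \<longrightarrow>
            (\<lambda>n. dual_norm S (\<lambda>y. s n y - g y)) \<longlonglongrightarrow> 0 \<longrightarrow> g \<in> T ` X) \<and>
     (\<exists>B. finite B \<and> independent B \<and> span B = {x\<in>X. T x = (\<lambda>_. 0)} \<and>
        (\<exists>b::nat \<Rightarrow> 'y \<Rightarrow> real. (\<forall>i<card B. b i \<in> dual_sp S) \<and>
           (\<forall>c. (\<lambda>y. \<Sum>i<card B. c i * b i y) \<in> T ` X \<longrightarrow> (\<forall>i<card B. c i = 0)) \<and>
           (\<forall>g\<in>dual_sp S. \<exists>x\<in>X. \<exists>c. g = (\<lambda>y. T x y + (\<Sum>i<card B. c i * b i y)))))"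

definition compact_op :: "('a::real_normed_vector \<Rightarrow> 'b::real_normed_vector) \<Rightarrow> bool" where
  "compact_op T \<longleftrightarrow> bounded_linear T \<and> compact (closure (T ` ball 0 1))"

end

theory Submission
  imports Defs
begin

text \<open>
  Let \<open>l \<omega>\<close> be the Lagrange multiplier, i.e. the functional on \<open>\<real>\<^sup>m\<close> with
  \<open>\<E>'(\<phi> \<omega>) = l \<omega> \<circ> \<G>'(\<phi> \<omega>)\<close> on \<open>V1\<close>. The extension of \<open>\<F>'(\<omega>)\<close> is the restriction of
  \<open>\<E>'(\<phi> \<omega>) - l \<omega> \<circ> \<G>'(\<phi> \<omega>)\<close> to the \<open>Y\<close>-closure \<open>S\<close> of \<open>V0\<close>. Since \<open>S\<close> is the kernel of
  \<open>\<G>'(ubar)\<close> on \<open>Y\<close>, the derivative of \<open>l\<close> drops out at \<open>\<omega>bar\<close>, so only continuity of \<open>l\<close> is needed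
  and \<open>\<F>''\<close> is the restriction of \<open>T = \<E>'' - l \<circ> \<G>''\<close> to \<open>V0\<close> and \<open>S\<close>.
  By compactness of \<open>\<G>''\<close>, \<open>T\<close> is Fredholm of index zero; it differs by a finite-rank operator from
  an operator that is block diagonal with respect to \<open>V = V0 + V1\<close> and \<open>Y = S + \<iota> V1\<close>, whose
  blocks are \<open>\<F>''\<close> and an isomorphism of \<open>m\<close>-dimensional spaces.

  Stability of index zero under a compact perturbation \<open>K\<close>: write \<open>T = A - F\<close> with \<open>A\<close> bijective
  and \<open>F\<close> of finite rank (the coordinate functionals on the kernel come from Hahn-Banach). Then
  \<open>T + K = A \<circ> (I - C)\<close> with \<open>C\<close> compact, and \<open>I - C\<close> has index zero by Riesz theory.
\<close>

section \<open>The Hahn-Banach theorem for closed subspaces\<close>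

text \<open>Homogeneity is asked only as an inequality for positive scalars, the form that is
  easiest to check for infima; \<open>sublinear_zero\<close> and \<open>sublinear_scale\<close>
  recover equality for all nonnegative scalars.\<close>

definition sublinear :: "('a::real_vector \<Rightarrow> real) \<Rightarrow> bool" where
  "sublinear p \<longleftrightarrow> (\<forall>x y. p (x + y) \<le> p x + p y) \<and> (\<forall>x t. 0 < t \<longrightarrow> p (t *\<^sub>R x) \<le> t * p x)"

lemma sublinear_zero:
  assumes "sublinear p"
  shows "p 0 = 0"
proof -
  have "p (0 + 0) \<le> p 0 + p 0" "p ((1/2) *\<^sub>R 0) \<le> (1/2) * p 0"
    using assms unfolding sublinear_def by (blast, metis half_gt_zero_iff zero_less_one)
  then show ?thesis by simp
qed

lemma sublinear_scale:
  assumes "sublinear p" "0 \<le> t"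
  shows "p (t *\<^sub>R x) = t * p x"
proof (cases "t = 0")
  case True
  then show ?thesis by (simp add: sublinear_zero[OF assms(1)])
next
  case False
  then have t: "0 < t" using assms by simp
  have "p ((1/t) *\<^sub>R (t *\<^sub>R x)) \<le> (1/t) * p (t *\<^sub>R x)"
    using assms(1) t unfolding sublinear_def by (meson zero_less_divide_1_iff)
  moreover have "p (t *\<^sub>R x) \<le> t * p x"
    using assms(1) t unfolding sublinear_def by blast
  ultimately show ?thesis using t by (simp add: field_simps)
qed

lemma sublinear_minus_le:
  assumes "sublinear p"
  shows "- p (- x) \<le> p x"
proof -
  have "p (x + - x) \<le> p x + p (- x)" using assms unfolding sublinear_def by blast
  then show ?thesis using sublinear_zero[OF assms] by simp
qed

text \<open>The lowered functional is the infimum of p(x + t y) - t p(y) over t >= 0; the parameters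
  t = 0 and t = 1 give the two bounds. It serves twice: it forces a minimal functional to be odd,
  and in the separation theorem it makes a functional positive at a prescribed vector.\<close>

lemma sublinear_shift:
  fixes p :: "'a::real_vector \<Rightarrow> real"
  assumes p: "sublinear p"
  obtains q where "sublinear q" "\<And>x. q x \<le> p x" "q (- y) \<le> - p y"
proof
  define g where "g x t = p (x + t *\<^sub>R y) - t * p y" for x t
  define q where "q x = (INF t\<in>{0..}. g x t)" for x
  have sub: "p (u + v) \<le> p u + p v" for u v using p unfolding sublinear_def by blast
  have bdd: "bdd_below (g x ` {0..})" for x
  proof (rule bdd_belowI2[of _ "- p (- x)"])
    fix t :: real assume "t \<in> {0..}"
    then have "t * p y = p (t *\<^sub>R y)" by (simp add: sublinear_scale[OF p])
    also have "\<dots> \<le> p (x + t *\<^sub>R y) + p (- x)" using sub[of "x + t *\<^sub>R y" "- x"] by simp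
    finally show "- p (- x) \<le> g x t" by (simp add: g_def)
  qed
  have le: "q x \<le> g x t" if "0 \<le> t" for x t
    unfolding q_def using bdd that by (intro cINF_lower) auto
  have ge: "c \<le> q x" if "\<And>t. 0 \<le> t \<Longrightarrow> c \<le> g x t" for c x
    unfolding q_def using that by (intro cINF_greatest) auto
  show "q x \<le> p x" for x using le[of 0 x] by (simp add: g_def)
  show "q (- y) \<le> - p y" using le[of 1 "- y"] by (simp add: g_def sublinear_zero[OF p])
  show "sublinear q" unfolding sublinear_def
  proof (intro conjI allI impI)
    fix x z
    have *: "q (x + z) \<le> g x s + g z t" if "0 \<le> s" "0 \<le> t" for s t
    proof -
      have "q (x + z) \<le> g (x + z) (s + t)" using that by (intro le) simp
      also have "\<dots> \<le> g x s + g z t"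
        using sub[of "x + s *\<^sub>R y" "z + t *\<^sub>R y"]
        by (simp add: g_def algebra_simps)
      finally show ?thesis .
    qed
    have "q (x + z) - g z t \<le> q x" if "0 \<le> t" for t
      using *[OF _ that] by (intro ge) (simp add: algebra_simps)
    then have "q (x + z) - q x \<le> q z" by (intro ge) (simp add: algebra_simps)
    then show "q (x + z) \<le> q x + q z" by simp
  next
    fix x and s :: real assume s: "0 < s"
    \<comment> \<open>The parameter t for x corresponds to s t for s x, so the infimum scales with
      s.\<close>
    have "q (s *\<^sub>R x) / s \<le> g x t" if t: "0 \<le> t" for t
    proof -
      have "q (s *\<^sub>R x) \<le> g (s *\<^sub>R x) (s * t)" using s t by (intro le) simp
      also have "\<dots> = s * g x t"
        using sublinear_scale[OF p, of s "x + t *\<^sub>R y"] s by (simp add: g_def algebra_simps)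
      finally show ?thesis using s by (simp add: field_simps)
    qed
    then have "q (s *\<^sub>R x) / s \<le> q x" by (intro ge)
    then show "q (s *\<^sub>R x) \<le> s * q x" using s by (simp add: field_simps)
  qed
qed

text \<open>A pointwise minimal sublinear functional is linear: \<open>sublinear_shift\<close> would lower it in any
  direction in which it failed to be additive.\<close>
lemma linear_below_sublinear:
  fixes p :: "'a::real_vector \<Rightarrow> real"
  assumes p: "sublinear p"
  obtains f where "linear f" "\<And>x. f x \<le> p x"
proof -
  let ?A = "{q. sublinear q \<and> q \<le> p}"
  \<comment> \<open>The order is reversed: an element that is maximal for \<open>?P\<close> is a
    pointwise minimal sublinear functional below p.\<close>
  let ?P = "\<lambda>q r :: 'a \<Rightarrow> real. r \<le> q"
  have "\<exists>m\<in>?A. \<forall>a\<in>?A. ?P m a \<longrightarrow> a = m"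
  proof (rule predicate_Zorn)
    show "partial_order_on ?A (relation_of ?P ?A)"
      by (rule partial_order_on_relation_ofI) auto
  next
    fix C assume C: "C \<in> Chains (relation_of ?P ?A)"
    then have CA: "\<And>q. q \<in> C \<Longrightarrow> sublinear q \<and> q \<le> p"
      and ch: "\<And>q r. q \<in> C \<Longrightarrow> r \<in> C \<Longrightarrow> q \<le> r \<or> r \<le> q"
      unfolding Chains_def relation_of_def by auto
    show "\<exists>u\<in>?A. \<forall>a\<in>C. ?P a u"
    proof (cases "C = {}")
      case True
      then show ?thesis using p by auto
    next
      case False
      define u where "u x = (INF q\<in>C. q x)" for x
      have bdd: "bdd_below ((\<lambda>q. q x) ` C)" for x
      proof (rule bdd_belowI2[of _ "- p (- x)"])
        fix q assume "q \<in> C"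
        then show "- p (- x) \<le> q x"
          using sublinear_minus_le[of q x] CA[of q] le_funD[of q p "- x"] by force
      qed
      have le: "u x \<le> q x" if "q \<in> C" for x q
        unfolding u_def using bdd that by (intro cINF_lower) auto
      have ge: "c \<le> u x" if "\<And>q. q \<in> C \<Longrightarrow> c \<le> q x" for c x
        unfolding u_def using that False by (intro cINF_greatest) auto
      have "sublinear u" unfolding sublinear_def
      proof (intro conjI allI impI)
        fix x y
        \<comment> \<open>Of two members of a chain the smaller one bounds both terms; this makes
          the infimum over the chain subadditive.\<close>
        have *: "u (x + y) \<le> q x + r y" if "q \<in> C" "r \<in> C" for q r
        proof -
          obtain s where s: "s \<in> C" "s \<le> q" "s \<le> r"
            using ch[OF \<open>q \<in> C\<close> \<open>r \<in> C\<close>] \<open>q \<in> C\<close> \<open>r \<in> C\<close> by (metis order_refl)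
          have "u (x + y) \<le> s (x + y)" using s by (intro le)
          also have "\<dots> \<le> s x + s y" using CA[OF s(1)] unfolding sublinear_def by blast
          also have "\<dots> \<le> q x + r y" using s by (simp add: add_mono le_fun_def)
          finally show ?thesis .
        qed
        have "u (x + y) - r y \<le> u x" if "r \<in> C" for r
          using *[OF _ that] by (intro ge) (simp add: algebra_simps)
        then have "u (x + y) - u x \<le> u y" by (intro ge) (simp add: algebra_simps)
        then show "u (x + y) \<le> u x + u y" by simp
      next
        fix x and t :: real assume t: "0 < t"
        have "u (t *\<^sub>R x) / t \<le> q x" if "q \<in> C" for q
          using le[OF that, of "t *\<^sub>R x"] sublinear_scale[of q t x] CA[OF that] t
          by (simp add: field_simps)
        then have "u (t *\<^sub>R x) / t \<le> u x" by (intro ge)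
        then show "u (t *\<^sub>R x) \<le> t * u x" using t by (simp add: field_simps)
      qed
      moreover have "u \<le> p"
        using False le CA by (meson ex_in_conv le_fun_def order_trans)
      ultimately show ?thesis using le by (auto simp: le_fun_def)
    qed
  qed
  then obtain m where m: "sublinear m" "m \<le> p"
    and min: "\<And>q. sublinear q \<Longrightarrow> q \<le> m \<Longrightarrow> q = m"
    using order_trans[of _ _ p] by blast
  have neg: "m (- y) = - m y" for y
  proof -
    obtain q where q: "sublinear q" "\<And>x. q x \<le> m x" "q (- y) \<le> - m y"
      using sublinear_shift[OF m(1)] by blast
    \<comment> \<open>By minimality the lowering changes nothing, so m(-y) <= -m(y); the reverse
      inequality is \<open>sublinear_minus_le\<close>.\<close>
    then have "q = m" by (intro min) (auto simp: le_fun_def)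
    then show ?thesis using q(3) sublinear_minus_le[OF m(1), of y] by simp
  qed
  have sub: "m (u + v) \<le> m u + m v" for u v using m unfolding sublinear_def by blast
  have "linear m"
  proof (rule linearI)
    show "m (x + y) = m x + m y" for x y
      using sub[of x y] sub[of "x + y" "- y"] neg[of y] by simp
    show "m (r *\<^sub>R x) = r *\<^sub>R m x" for r x
      using sublinear_scale[OF m(1), of "\<bar>r\<bar>" x] neg[of "\<bar>r\<bar> *\<^sub>R x"] by (cases "r \<ge> 0") auto
  qed
  then show thesis using that m(2) by (auto simp: le_fun_def)
qed

section \<open>Separation of a point from a closed subspace\<close>

lemma infdist_subspace_sublinear:
  fixes M :: "'a::real_normed_vector set"
  assumes M: "subspace M"
  shows "sublinear (\<lambda>x. infdist x M)"
proof -
  have ne: "M \<noteq> {}" using M subspace_0 by blast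
  have le: "infdist x M \<le> norm (x - z)" if "z \<in> M" for x z
    using infdist_le[OF that, of x] by (simp add: dist_norm)
  have ge: "c \<le> infdist x M" if "\<And>z. z \<in> M \<Longrightarrow> c \<le> norm (x - z)" for c x
    using that ne by (simp add: infdist_def dist_norm cINF_greatest)
  show ?thesis unfolding sublinear_def
  proof (intro conjI allI impI)
    fix x y
    have *: "infdist (x + y) M \<le> norm (x - u) + norm (y - v)" if "u \<in> M" "v \<in> M" for u v
      using le[OF subspace_add[OF M that], of "x + y"] norm_triangle_ineq[of "x - u" "y - v"]
      by (simp add: algebra_simps)
    have "infdist (x + y) M - norm (y - v) \<le> infdist x M" if "v \<in> M" for v
      using *[OF _ that] by (intro ge) (simp add: algebra_simps)
    then have "infdist (x + y) M - infdist x M \<le> infdist y M"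
      by (intro ge) (simp add: algebra_simps)
    then show "infdist (x + y) M \<le> infdist x M + infdist y M" by simp
  next
    fix x and t :: real assume t: "0 < t"
    have "infdist (t *\<^sub>R x) M / t \<le> norm (x - z)" if "z \<in> M" for z
    proof -
      have "infdist (t *\<^sub>R x) M \<le> norm (t *\<^sub>R (x - z))"
        unfolding scaleR_diff_right by (rule le[OF subspace_scale[OF M that]])
      then have "infdist (t *\<^sub>R x) M \<le> norm (x - z) * t" using t by (simp add: mult.commute)
      then show ?thesis using t by (simp add: pos_divide_le_eq)
    qed
    then have "infdist (t *\<^sub>R x) M / t \<le> infdist x M" by (intro ge)
    then show "infdist (t *\<^sub>R x) M \<le> t * infdist x M" using t by (simp add: field_simps)
  qed
qed

lemma infdist_subspace_pos:
  assumes "closed M" "subspace M" "a \<notin> M"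
  shows "0 < infdist a M"
proof -
  have "infdist a M \<noteq> 0"
    using assms in_closed_iff_infdist_zero[of M a] subspace_0 by blast
  then show ?thesis using infdist_nonneg[of a M] by linarith
qed

text \<open>The distance to M is the quotient seminorm, so a linear functional below it is bounded
  by the norm and vanishes on M. To make it nonzero at a, the distance is first lowered in the
  direction of a: then f(-a) <= -dist(a, M) < 0, and f can be normalised.\<close>

lemma hahn_banach_separation:
  fixes M :: "'a::real_normed_vector set"
  assumes M: "closed M" "subspace M" and a: "a \<notin> M"
  obtains f :: "'a \<Rightarrow> real" where "bounded_linear f" "f a = 1" "\<And>x. x \<in> M \<Longrightarrow> f x = 0"
proof -
  let ?p = "\<lambda>x. infdist x M"
  obtain q where q: "sublinear q" "\<And>x. q x \<le> ?p x" "q (- a) \<le> - ?p a"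
    using sublinear_shift[OF infdist_subspace_sublinear[OF M(2)]] by blast
  obtain f where f: "linear f" "\<And>x. f x \<le> q x" using linear_below_sublinear[OF q(1)] by blast
  have fp: "f x \<le> ?p x" for x using f(2)[of x] q(2)[of x] by simp
  have neg: "f (- x) = - f x" for x using linear_neg[OF f(1)] .
  have fa: "f a > 0" using f(2)[of "- a"] q(3) neg[of a] infdist_subspace_pos[OF M a] by simp
  have "0 \<in> M" using M(2) subspace_0 by blast
  then have "?p x \<le> norm x" for x using infdist_le[of 0 M x] by simp
  then have "\<bar>f x\<bar> \<le> norm x" for x
    using fp[of x] fp[of "- x"] neg[of x] by (metis abs_le_iff norm_minus_cancel order_trans)
  then have bl: "bounded_linear f"
    using f(1) by (intro bounded_linear_intro[of _ 1]) (auto simp: linear_add linear_scale)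
  have f0: "f x = 0" if "x \<in> M" for x
    using fp[of x] fp[of "- x"] neg[of x] that subspace_neg[OF M(2) that] by simp
  show thesis
  proof (rule that[of "\<lambda>x. f x / f a"])
    show "bounded_linear (\<lambda>x. f x / f a)" using bl by (rule bounded_linear_divide[THEN bounded_linear_compose])
  qed (use fa f0 in auto)
qed

text \<open>Induction over the spanning set: a functional f that vanishes on \<open>span B\<close>
  with f(a) = 1 reads off the coefficient of a, so the larger span is the preimage of
  \<open>span B\<close> under the continuous map y - f(y) a.\<close>

lemma closed_span_finite:
  fixes B :: "'a::real_normed_vector set"
  assumes "finite B"
  shows "closed (span B)"
  using assms
proof induction
  case empty
  then show ?case by simp
next
  case (insert a B)
  show ?case
  proof (cases "a \<in> span B")
    case True
    then show ?thesis using insert span_redundant by metis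
  next
    case False
    obtain f where f: "bounded_linear f" "f a = (1::real)" "\<And>x. x \<in> span B \<Longrightarrow> f x = 0"
      using hahn_banach_separation[OF insert.IH subspace_span False] by blast
    interpret f: bounded_linear f by fact
    have "y \<in> span (insert a B) \<longleftrightarrow> y - f y *\<^sub>R a \<in> span B" for y
    proof
      assume "y \<in> span (insert a B)"
      then obtain k where k: "y - k *\<^sub>R a \<in> span B" by (auto simp: span_insert)
      from f(3)[OF this] have "f y = k" by (simp add: f.diff f.scaleR f(2))
      then show "y - f y *\<^sub>R a \<in> span B" using k by simp
    qed (auto simp: span_insert)
    then have "span (insert a B) = (\<lambda>y. y - f y *\<^sub>R a) -` span B" by auto
    moreover have "continuous_on UNIV (\<lambda>y. y - f y *\<^sub>R a)"
      by (intro continuous_intros linear_continuous_on f)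
    ultimately show ?thesis using insert.IH by (metis closed_vimage)
  qed
qed

text \<open>Each e is separated from the span of the other basis vectors, which is closed because it
  is finite-dimensional.\<close>

lemma dual_basis:
  fixes B :: "'a::real_normed_vector set"
  assumes "finite B" "independent B"
  obtains f :: "'a \<Rightarrow> 'a \<Rightarrow> real"
  where "\<And>e. e \<in> B \<Longrightarrow> bounded_linear (f e)"
    "\<And>e e'. e \<in> B \<Longrightarrow> e' \<in> B \<Longrightarrow> f e e' = (if e = e' then 1 else 0)"
proof -
  have "\<exists>f :: 'a \<Rightarrow> real. bounded_linear f \<and> f e = 1 \<and> (\<forall>x\<in>span (B - {e}). f x = 0)" if "e \<in> B" for e
  proof (rule hahn_banach_separation)
    show "closed (span (B - {e}))" using assms(1) by (intro closed_span_finite) simp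
    show "e \<notin> span (B - {e})" using assms(2) that unfolding dependent_def by blast
  qed auto
  then obtain f :: "'a \<Rightarrow> 'a \<Rightarrow> real" where f: "\<And>e. e \<in> B \<Longrightarrow> bounded_linear (f e)"
    "\<And>e. e \<in> B \<Longrightarrow> f e e = 1" "\<And>e x. e \<in> B \<Longrightarrow> x \<in> span (B - {e}) \<Longrightarrow> f e x = 0"
    by metis
  show thesis by (rule that[of f]) (auto simp: f intro: f(3) span_base)
qed

section \<open>The bounded inverse theorem\<close>

text \<open>The Baire half of the open mapping theorem. The closures of the images of the balls of
  radius n cover the target, so one of them contains a ball around some y0; subtracting approximate
  preimages of y0 and of y0 plus a small vector approximates that small vector.\<close>

lemma surj_approx_preimage:
  fixes A :: "'a::real_normed_vector \<Rightarrow> 'b::banach"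
  assumes A: "bounded_linear A" "surj A"
  obtains M where "0 \<le> M" "\<And>y. \<exists>x. norm x \<le> M * norm y \<and> norm (y - A x) \<le> norm y / 2"
proof -
  interpret A: bounded_linear A by fact
  define C where "C n = closure (A ` cball 0 (real n))" for n :: nat
  have "\<exists>n. interior (C n) \<noteq> {}"
  proof (rule ccontr)
    assume "\<nexists>n. interior (C n) \<noteq> {}"
    moreover have "completely_metrizable_space (euclidean :: 'b topology)"
      by (rule completely_metrizable_space_euclidean)
    ultimately have "euclidean interior_of (\<Union>(range C)) = {}"
      by (intro Baire_category_alt) (auto simp: C_def)
    moreover have "y \<in> \<Union>(range C)" for y
    proof -
      obtain x where "y = A x" using A(2) by blast
      moreover obtain n where "norm x \<le> real n" using real_arch_simple by blast
      ultimately have "y \<in> C n" unfolding C_def by (intro closure_subset[THEN subsetD]) auto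
      then show ?thesis by blast
    qed
    then have "\<Union>(range C) = UNIV" by blast
    ultimately show False by simp
  qed
  then obtain n y0 where "y0 \<in> interior (C n)" by blast
  then obtain e where e: "0 < e" "ball y0 e \<subseteq> C n" by (meson mem_interior)
  have near: "\<exists>x. norm x \<le> real n \<and> norm (z - A x) < e / 8" if "norm (z - y0) < e" for z
  proof -
    have "z \<in> C n" using that e(2) by (auto simp: dist_norm norm_minus_commute)
    then obtain w where "w \<in> A ` cball 0 (real n)" "dist w z < e / 8"
      unfolding C_def closure_approachable using e(1) by (meson divide_pos_pos zero_less_numeral)
    then show ?thesis by (auto simp: dist_norm norm_minus_commute)
  qed
  show thesis
  proof (rule that[of "4 * real n / e"])
    show "0 \<le> 4 * real n / e" using e by simp
    fix y
    show "\<exists>x. norm x \<le> 4 * real n / e * norm y \<and> norm (y - A x) \<le> norm y / 2"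
    proof (cases "y = 0")
      case True
      then show ?thesis by (intro exI[of _ 0]) (simp add: A.zero)
    next
      case False
      \<comment> \<open>Dividing by s gives y the norm e/2, which keeps y0 + y/s in the ball. Two
        errors of e/8 add up to e/4, and multiplying by s turns this into half the norm of y; the
        bound 2n on x1 - x2 becomes 4n/e times the norm of y.\<close>
      define s where "s = 2 * norm y / e"
      have s: "0 < s" using False e by (simp add: s_def)
      obtain x1 where x1: "norm x1 \<le> real n" "norm (y0 + (1/s) *\<^sub>R y - A x1) < e / 8"
        using near[of "y0 + (1/s) *\<^sub>R y"] False e by (auto simp: s_def)
      obtain x2 where x2: "norm x2 \<le> real n" "norm (y0 - A x2) < e / 8"
        using near[of y0] e by auto
      have "norm (x1 - x2) \<le> 2 * real n" using x1 x2 norm_triangle_ineq4[of x1 x2] by simp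
      then have "s * norm (x1 - x2) \<le> s * (2 * real n)" using s by simp
      then have 1: "norm (s *\<^sub>R (x1 - x2)) \<le> 4 * real n / e * norm y"
      proof -
        have "norm (s *\<^sub>R (x1 - x2)) = s * norm (x1 - x2)" using s by simp
        also have "\<dots> \<le> s * (2 * real n)" by fact
        finally show ?thesis by (simp add: s_def mult.assoc mult.commute mult.left_commute)
      qed
      have "norm ((1/s) *\<^sub>R y - A (x1 - x2)) \<le> e / 4"
        using x1 x2 norm_triangle_ineq4[of "y0 + (1/s) *\<^sub>R y - A x1" "y0 - A x2"]
        by (simp add: A.diff algebra_simps)
      then have "s * norm ((1/s) *\<^sub>R y - A (x1 - x2)) \<le> s * (e / 4)" using s by simp
      moreover have "norm (y - A (s *\<^sub>R (x1 - x2))) = s * norm ((1/s) *\<^sub>R y - A (x1 - x2))"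
      proof -
        have "y - A (s *\<^sub>R (x1 - x2)) = s *\<^sub>R ((1/s) *\<^sub>R y - A (x1 - x2))"
          using s by (simp add: A.scaleR A.diff scaleR_diff_right)
        then show ?thesis using s by simp
      qed
      ultimately have "norm (y - A (s *\<^sub>R (x1 - x2))) \<le> norm y / 2"
        using e by (simp add: s_def)
      with 1 show ?thesis by blast
    qed
  qed
qed

text \<open>Approximate solving is repeated on the residuals. These halve at each step, so the
  corrections form an absolutely convergent series whose sum, by completeness of the domain, is an
  exact preimage.\<close>

lemma surj_preimage_bound:
  fixes A :: "'a::banach \<Rightarrow> 'b::banach"
  assumes A: "bounded_linear A" "surj A"
  obtains K where "0 < K" "\<And>y. \<exists>x. A x = y \<and> norm x \<le> K * norm y"
proof -
  interpret A: bounded_linear A by fact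
  obtain M g where M: "0 \<le> M" and g: "\<And>y. norm (g y) \<le> M * norm y" "\<And>y. norm (y - A (g y)) \<le> norm y / 2"
    using surj_approx_preimage[OF A] by metis
  \<comment> \<open>The geometric series gives the constant 2M; adding 1 makes it strictly
    positive.\<close>
  have "\<exists>x. A x = y \<and> norm x \<le> (2 * M + 1) * norm y" for y
  proof -
    define r where "r n = ((\<lambda>z. z - A (g z)) ^^ n) y" for n
    have r: "r 0 = y" "r (Suc n) = r n - A (g (r n))" for n by (simp_all add: r_def)
    have rn: "norm (r n) \<le> norm y * (1/2) ^ n" for n
    proof (induction n)
      case (Suc n)
      then show ?case using g(2)[of "r n"] r(2)[of n] by simp
    qed (simp add: r)
    have gn: "norm (g (r n)) \<le> M * norm y * (1/2) ^ n" for n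
      using g(1)[of "r n"] mult_left_mono[OF rn[of n] M] by (simp add: mult.assoc)
    have geo: "(\<lambda>n. M * norm y * (1/2) ^ n) sums (M * norm y * 2)"
      using sums_mult[OF geometric_sums[of "1/2::real"], of "M * norm y"] by simp
    have sm: "summable (\<lambda>n. norm (g (r n)))"
      by (rule summable_comparison_test'[OF sums_summable[OF geo], of 0]) (simp add: gn)
    define x where "x = (\<Sum>n. g (r n))"
    have "(\<lambda>n. A (g (r n))) sums A x"
      unfolding x_def by (rule A.sums[OF summable_sums[OF summable_norm_cancel[OF sm]]])
    moreover have "(\<lambda>n. A (g (r n))) sums (r 0 - 0)"
    proof -
      have "(\<lambda>n. norm y * (1/2) ^ n) \<longlonglongrightarrow> norm y * 0"
        by (intro tendsto_intros LIMSEQ_power_zero) simp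
      then have "r \<longlonglongrightarrow> 0"
        by (intro Lim_null_comparison[of r]) (auto simp: rn)
      from telescope_sums'[OF this] show ?thesis by (simp add: r(2))
    qed
    ultimately have "A x = y" using sums_unique2 r(1) by fastforce
    moreover have "norm x \<le> M * norm y * 2"
      unfolding x_def using summable_norm[OF sm] suminf_le[OF gn sm sums_summable[OF geo]] sums_unique[OF geo]
      by simp
    moreover have "(2 * M + 1) * norm y = M * norm y * 2 + norm y" by (simp add: algebra_simps)
    ultimately have "A x = y" "norm x \<le> (2 * M + 1) * norm y" using norm_ge_zero[of y] by linarith+
    then show ?thesis by blast
  qed
  then show thesis using that[of "2 * M + 1"] M by simp
qed

lemma bounded_linear_inv:
  fixes A :: "'a::banach \<Rightarrow> 'b::banach"
  assumes A: "bounded_linear A" "bij A"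
  shows "bounded_linear (inv A)"
proof -
  interpret A: bounded_linear A by fact
  note inj = bij_is_inj[OF A(2)] and surj = bij_is_surj[OF A(2)]
  obtain K where K: "\<And>y. \<exists>x. A x = y \<and> norm x \<le> K * norm y"
    using surj_preimage_bound[OF A(1) surj] by metis
  show ?thesis
  proof (rule bounded_linear_intro)
    show "inv A (x + y) = inv A x + inv A y" for x y
      by (rule inv_f_eq[OF inj]) (simp add: A.add surj_f_inv_f[OF surj])
    show "inv A (r *\<^sub>R x) = r *\<^sub>R inv A x" for r x
      by (rule inv_f_eq[OF inj]) (simp add: A.scaleR surj_f_inv_f[OF surj])
    show "norm (inv A y) \<le> norm y * K" for y
      using K[of y] inv_f_eq[OF inj] by (metis mult.commute)
  qed
qed

section \<open>Riesz theory of compact operators\<close>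

text \<open>The sequential form of compactness, from which convergent subsequences are extracted
  directly; \<open>compact_op_imp_compact_map\<close> links it to \<open>compact_op\<close>.\<close>

definition compact_map :: "('a::real_normed_vector \<Rightarrow> 'b::real_normed_vector) \<Rightarrow> bool" where
  "compact_map T \<longleftrightarrow> bounded_linear T \<and>
     (\<forall>x :: nat \<Rightarrow> 'a. bounded (range x) \<longrightarrow> (\<exists>l r. strict_mono (r :: nat \<Rightarrow> nat) \<and> (\<lambda>n. T (x (r n))) \<longlonglongrightarrow> l))"

lemma compact_map_bounded_linear: "compact_map T \<Longrightarrow> bounded_linear T"
  by (simp add: compact_map_def)

lemma compact_mapE:
  fixes x :: "nat \<Rightarrow> 'a::real_normed_vector"
  assumes "compact_map T" "bounded (range x)"
  obtains l and r :: "nat \<Rightarrow> nat" where "strict_mono r" "(\<lambda>n. T (x (r n))) \<longlonglongrightarrow> l"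
  using assms unfolding compact_map_def by blast

lemma compact_op_imp_compact_map:
  fixes T :: "'a::real_normed_vector \<Rightarrow> 'b::real_normed_vector"
  assumes "compact_op T"
  shows "compact_map T"
  unfolding compact_map_def
proof (intro conjI allI impI)
  show bl: "bounded_linear T" using assms by (simp add: compact_op_def)
  interpret bounded_linear T by fact
  fix x :: "nat \<Rightarrow> 'a" assume "bounded (range x)"
  \<comment> \<open>The strict bound places the rescaled sequence in the open unit ball used by
    \<open>compact_op\<close>.\<close>
  then obtain M where M: "M > 0" "\<And>n. norm (x n) < M"
    by (metis bounded_pos_less rangeI)
  have "seq_compact (closure (T ` ball 0 1))"
    using assms by (simp add: compact_op_def compact_imp_seq_compact)
  moreover have "T ((1/M) *\<^sub>R x n) \<in> closure (T ` ball 0 1)" for n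
    using M by (intro closure_subset[THEN subsetD] imageI) auto
  ultimately obtain l r where r: "strict_mono (r :: nat \<Rightarrow> nat)" "(\<lambda>n. T ((1/M) *\<^sub>R x (r n))) \<longlonglongrightarrow> l"
    unfolding seq_compact_def o_def by meson
  from tendsto_scaleR[OF tendsto_const[of M] r(2)] have "(\<lambda>n. T (x (r n))) \<longlonglongrightarrow> M *\<^sub>R l"
    using M by (simp add: scaleR)
  then show "\<exists>l r. strict_mono (r :: nat \<Rightarrow> nat) \<and> (\<lambda>n. T (x (r n))) \<longlonglongrightarrow> l" using r(1) by blast
qed

lemma compact_map_zero: "compact_map (\<lambda>_. 0)"
  unfolding compact_map_def using strict_mono_id by auto

lemma compact_map_compose_left:
  assumes T: "compact_map T" and S: "bounded_linear S"
  shows "compact_map (\<lambda>x. S (T x))"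
  unfolding compact_map_def
proof (intro conjI allI impI)
  show "bounded_linear (\<lambda>x. S (T x))"
    by (rule bounded_linear_compose[OF S compact_map_bounded_linear[OF T]])
  fix x :: "nat \<Rightarrow> 'a" assume "bounded (range x)"
  with T obtain l r where "strict_mono (r :: nat \<Rightarrow> nat)" "(\<lambda>n. T (x (r n))) \<longlonglongrightarrow> l"
    by (rule compact_mapE)
  then show "\<exists>l r. strict_mono (r :: nat \<Rightarrow> nat) \<and> (\<lambda>n. S (T (x (r n)))) \<longlonglongrightarrow> l"
    using bounded_linear.tendsto[OF S] by blast
qed

lemma compact_map_compose_right:
  assumes T: "compact_map T" and S: "bounded_linear S"
  shows "compact_map (\<lambda>x. T (S x))"
  unfolding compact_map_def
proof (intro conjI allI impI)
  show "bounded_linear (\<lambda>x. T (S x))"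
    by (rule bounded_linear_compose[OF compact_map_bounded_linear[OF T] S])
  fix x :: "nat \<Rightarrow> 'c" assume "bounded (range x)"
  then have "bounded (range (\<lambda>n. S (x n)))"
    using bounded_linear_image[OF _ S, of "range x"] by (simp add: image_image)
  with T obtain l r where "strict_mono (r :: nat \<Rightarrow> nat)" "(\<lambda>n. T (S (x (r n)))) \<longlonglongrightarrow> l"
    by (rule compact_mapE)
  then show "\<exists>l r. strict_mono (r :: nat \<Rightarrow> nat) \<and> (\<lambda>n. T (S (x (r n)))) \<longlonglongrightarrow> l" by blast
qed

lemma compact_map_add:
  assumes T: "compact_map T" and S: "compact_map S"
  shows "compact_map (\<lambda>x. T x + S x)"
  unfolding compact_map_def
proof (intro conjI allI impI)
  show "bounded_linear (\<lambda>x. T x + S x)"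
    using assms by (intro bounded_linear_add compact_map_bounded_linear)
  fix x :: "nat \<Rightarrow> 'a" assume x: "bounded (range x)"
  with T obtain l r where r: "strict_mono (r :: nat \<Rightarrow> nat)" "(\<lambda>n. T (x (r n))) \<longlonglongrightarrow> l"
    by (rule compact_mapE)
  have "bounded (range (\<lambda>n. x (r n)))" using x by (rule bounded_subset) auto
  with S obtain l' r' where r': "strict_mono (r' :: nat \<Rightarrow> nat)" "(\<lambda>n. S (x (r (r' n)))) \<longlonglongrightarrow> l'"
    by (rule compact_mapE)
  have "(\<lambda>n. T (x (r (r' n)))) \<longlonglongrightarrow> l" using LIMSEQ_subseq_LIMSEQ[OF r(2) r'(1)] by (simp add: o_def)
  from tendsto_add[OF this r'(2)] strict_mono_o[OF r(1) r'(1)]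
  show "\<exists>l r. strict_mono (r :: nat \<Rightarrow> nat) \<and> (\<lambda>n. T (x (r n)) + S (x (r n))) \<longlonglongrightarrow> l"
    by (auto simp: o_def)
qed

lemma compact_map_uminus: "compact_map T \<Longrightarrow> compact_map (\<lambda>x. - T x)"
  by (rule compact_map_compose_left[OF _ bounded_linear_minus[OF bounded_linear_ident]])

lemma compact_map_diff: "compact_map T \<Longrightarrow> compact_map S \<Longrightarrow> compact_map (\<lambda>x. T x - S x)"
  using compact_map_add[OF _ compact_map_uminus, of T S] by simp

lemma compact_map_heine_borel:
  fixes T :: "'a::real_normed_vector \<Rightarrow> 'b::{real_normed_vector, heine_borel}"
  assumes T: "bounded_linear T"
  shows "compact_map T"
  unfolding compact_map_def
proof (intro conjI allI impI)
  fix x :: "nat \<Rightarrow> 'a" assume "bounded (range x)"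
  then have "bounded (range (\<lambda>n. T (x n)))"
    using bounded_linear_image[OF _ T, of "range x"] by (simp add: image_image)
  from bounded_imp_convergent_subsequence[OF this]
  show "\<exists>l r. strict_mono (r :: nat \<Rightarrow> nat) \<and> (\<lambda>n. T (x (r n))) \<longlonglongrightarrow> l"
    by (simp add: o_def)
qed (rule T)

lemma compact_map_finite_rank:
  fixes f :: "'i \<Rightarrow> 'a::real_normed_vector \<Rightarrow> real"
  assumes "\<And>i. i \<in> I \<Longrightarrow> bounded_linear (f i)"
  shows "compact_map (\<lambda>x. \<Sum>i\<in>I. f i x *\<^sub>R b i)"
  using assms
proof (induction I rule: infinite_finite_induct)
  case (insert i I)
  \<comment> \<open>A rank-one map factors through the real line, where boundedness gives convergent
    subsequences.\<close>
  have "compact_map (\<lambda>x. f i x *\<^sub>R b i)"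
    by (rule compact_map_compose_left[OF compact_map_heine_borel bounded_linear_scaleR_left])
       (use insert.prems in auto)
  then show ?case using insert by (simp add: compact_map_add)
qed (simp_all add: compact_map_zero)

text \<open>The common source of contradiction in the Riesz theory: Riesz's lemma yields unit
  vectors whose images under C stay at mutual distance at least 1/2.\<close>

lemma compact_map_not_separated:
  fixes x :: "nat \<Rightarrow> 'a::real_normed_vector"
  assumes C: "compact_map C" and x: "bounded (range x)" and e: "0 < e"
    and sep: "\<And>m n. m < n \<Longrightarrow> e \<le> norm (C (x m) - C (x n))"
  shows False
proof -
  obtain l r where r: "strict_mono (r :: nat \<Rightarrow> nat)" "(\<lambda>n. C (x (r n))) \<longlonglongrightarrow> l"
    using C x by (rule compact_mapE)
  then have "Cauchy (\<lambda>n. C (x (r n)))" using LIMSEQ_imp_Cauchy by blast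
  then obtain N where "\<And>m n. N \<le> m \<Longrightarrow> N \<le> n \<Longrightarrow> norm (C (x (r m)) - C (x (r n))) < e"
    using CauchyD[OF _ e] by blast
  from this[of N "Suc N"] sep[of "r N" "r (Suc N)"] r(1) show False
    by (simp add: strict_mono_def)
qed

text \<open>Normalise x - s for some s in S that is closer to x than twice the distance d > 0 from x
  to S. The vector stays in L, which allows the use along chains of subspaces.\<close>

lemma riesz_lemma:
  fixes S L :: "'a::real_normed_vector set"
  assumes S: "closed S" "subspace S" and L: "subspace L" "S \<subseteq> L" "x \<in> L" "x \<notin> S"
  obtains u where "u \<in> L" "norm u = 1" "\<And>z. z \<in> S \<Longrightarrow> 1/2 \<le> norm (u - z)"
proof -
  define d where "d = infdist x S"
  have d: "0 < d" unfolding d_def by (rule infdist_subspace_pos[OF S L(4)])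
  have ne: "S \<noteq> {}" using S subspace_0 by blast
  have "\<exists>s\<in>S. dist x s < 2 * d"
  proof (rule ccontr)
    assume "\<not> ?thesis"
    then have "2 * d \<le> infdist x S" using ne by (auto simp: infdist_def intro!: cINF_greatest)
    then show False using d by (simp add: d_def)
  qed
  then obtain s where s: "s \<in> S" "norm (x - s) < 2 * d" by (auto simp: dist_norm)
  define t where "t = norm (x - s)"
  have t: "0 < t" using s L(4) by (auto simp: t_def)
  show thesis
  proof (rule that[of "(1/t) *\<^sub>R (x - s)"])
    show "(1/t) *\<^sub>R (x - s) \<in> L" using L s by (blast intro: subspace_scale subspace_diff)
    show "norm ((1/t) *\<^sub>R (x - s)) = 1" using t by (simp add: t_def)
    fix z assume z: "z \<in> S"
    \<comment> \<open>The point s + t z lies in S, so its distance from x is at least d; dividing by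
      t < 2d leaves more than 1/2.\<close>
    have "d \<le> norm (x - (s + t *\<^sub>R z))"
      unfolding d_def dist_norm[symmetric] using S s z
      by (intro infdist_le subspace_add subspace_scale)
    also have "x - (s + t *\<^sub>R z) = t *\<^sub>R ((1/t) *\<^sub>R (x - s) - z)"
      using t by (simp add: scaleR_diff_right)
    finally have "d \<le> t * norm ((1/t) *\<^sub>R (x - s) - z)" using t by simp
    moreover have "t < 2 * d" using s by (simp add: t_def)
    ultimately have "t * (1/2) < t * norm ((1/t) *\<^sub>R (x - s) - z)" by simp
    then show "1/2 \<le> norm ((1/t) *\<^sub>R (x - s) - z)" using t by simp
  qed
qed

section \<open>Fredholm theory of the identity minus a compact operator\<close>

locale riesz =
  fixes C :: "'a::banach \<Rightarrow> 'a"
  assumes C: "compact_map C"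
begin

sublocale C: bounded_linear C
  by (rule compact_map_bounded_linear[OF C])

definition R :: "'a \<Rightarrow> 'a" where "R x = x - C x"

sublocale R: bounded_linear R
  unfolding R_def by (intro bounded_linear_sub bounded_linear_ident C.bounded_linear_axioms)

lemma compact_decomp: "C x = x - R x"
  by (simp add: R_def)

text \<open>Every value of R has a preimage whose norm is at most twice its distance to the kernel.
  On such vectors R is bounded below, so preimages of a convergent sequence stay bounded, and
  compactness of C extracts a limit.\<close>

lemma closed_range_R: "closed (range R)"
proof -
  define N where "N = {x. R x = 0}"
  have N: "subspace N" unfolding N_def by (rule linear_subspace_kernel[OF R.linear])
  define good where "good u \<longleftrightarrow> (\<forall>w\<in>N. norm u \<le> 2 * norm (u - w))" for u
  have "\<exists>u. R u = R x \<and> good u" for x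
  proof (cases "x \<in> N")
    case True
    then show ?thesis by (intro exI[of _ 0]) (simp add: N_def R.zero good_def)
  next
    case False
    have cl: "closed N"
      unfolding N_def by (intro closed_Collect_eq R.continuous_on continuous_intros)
    have ne: "N \<noteq> {}" using N subspace_0 by blast
    have pos: "0 < infdist x N" by (rule infdist_subspace_pos[OF cl N False])
    obtain z where z: "z \<in> N" "norm (x - z) < 2 * infdist x N"
    proof (rule ccontr)
      assume "\<not> thesis"
      with that have "2 * infdist x N \<le> norm (x - z)" if "z \<in> N" for z using that by force
      then have "2 * infdist x N \<le> infdist x N"
        using ne by (subst (2) infdist_def) (auto intro!: cINF_greatest simp: dist_norm)
      then show False using pos by simp
    qed
    have "good (x - z)" unfolding good_def
    proof
      fix w assume "w \<in> N"
      then have "infdist x N \<le> norm (x - (z + w))"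
        unfolding dist_norm[symmetric] using z N by (intro infdist_le subspace_add)
      then show "norm (x - z) \<le> 2 * norm (x - z - w)" using z by (simp add: algebra_simps)
    qed
    moreover have "R (x - z) = R x" using z by (simp add: R.diff N_def)
    ultimately show ?thesis by blast
  qed
  then obtain g where g: "\<And>x. R (g x) = R x" "\<And>x. good (g x)" by metis
  have "\<exists>c>0. \<forall>u. good u \<longrightarrow> c * norm u \<le> norm (R u)"
  \<comment> \<open>Otherwise there are normalised good vectors w n with R(w n) tending to 0. Since
    w = R w + C w, a subsequence converges, and its limit lies in the kernel, although every w n has
    distance at least 1/2 from the kernel.\<close>
  proof (rule ccontr)
    assume "\<not> ?thesis"
    then have "\<exists>u. good u \<and> norm (R u) < inverse (real (Suc n)) * norm u" for n
      by (metis inverse_positive_iff_positive not_le of_nat_0_less_iff zero_less_Suc)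
    then obtain v where v: "\<And>n. good (v n)" "\<And>n. norm (R (v n)) < inverse (real (Suc n)) * norm (v n)"
      by metis
    define w where "w n = (1 / norm (v n)) *\<^sub>R v n" for n
    have nz: "0 < norm (v n)" for n
    proof (rule ccontr)
      assume "\<not> 0 < norm (v n)"
      then have "norm (v n) = 0" by simp
      then show False using v(2)[of n] by simp
    qed
    have w1: "norm (w n) = 1" for n using nz[of n] by (simp add: w_def)
    have wN: "1 \<le> 2 * norm (w n - z)" if "z \<in> N" for n z
    proof -
      have "norm (v n) \<le> 2 * norm (v n - norm (v n) *\<^sub>R z)"
        using v(1)[of n] subspace_scale[OF N that] by (simp add: good_def)
      also have "v n - norm (v n) *\<^sub>R z = norm (v n) *\<^sub>R (w n - z)"
        using nz[of n] by (simp add: w_def scaleR_diff_right)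
      finally show ?thesis using nz[of n] by simp
    qed
    have "norm (R (w n)) \<le> inverse (real (Suc n))" for n
      using v(2)[of n] nz[of n] by (simp add: w_def R.scaleR field_simps)
    then have Rw: "(\<lambda>n. R (w n)) \<longlonglongrightarrow> 0"
      by (intro Lim_null_comparison[OF _ LIMSEQ_inverse_real_of_nat]) auto
    have "bounded (range w)" using w1 by (auto simp: bounded_iff intro!: exI[of _ 1])
    with C obtain l r where r: "strict_mono (r :: nat \<Rightarrow> nat)" "(\<lambda>n. C (w (r n))) \<longlonglongrightarrow> l"
      by (rule compact_mapE)
    have Rr: "(\<lambda>n. R (w (r n))) \<longlonglongrightarrow> 0"
      using LIMSEQ_subseq_LIMSEQ[OF Rw r(1)] by (simp add: o_def)
    from tendsto_add[OF this r(2)] have wl: "(\<lambda>n. w (r n)) \<longlonglongrightarrow> l" by (simp add: R_def)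
    have "R l = 0" using LIMSEQ_unique[OF R.tendsto[OF wl] Rr] .
    then have "l \<in> N" by (simp add: N_def)
    moreover have "(\<lambda>n. 2 * norm (w (r n) - l)) \<longlonglongrightarrow> 2 * norm (l - l)"
      by (intro tendsto_intros wl)
    ultimately have "1 \<le> 2 * norm (l - l)"
      using wN by (intro LIMSEQ_le_const[of "\<lambda>n. 2 * norm (w (r n) - l)"]) auto
    then show False by simp
  qed
  then obtain c where c: "0 < c" "\<And>u. good u \<Longrightarrow> c * norm u \<le> norm (R u)" by blast
  have "y \<in> range R" if lim: "f \<longlonglongrightarrow> y" and f: "\<And>n. f n \<in> range R" for f y
  proof -
    have "\<exists>u. R u = f n \<and> good u" for n using f[of n] g by (metis rangeE)
    then obtain u where u: "\<And>n. R (u n) = f n" "\<And>n. good (u n)" by metis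
    obtain M where M: "\<And>n. norm (f n) \<le> M"
      using convergent_imp_bounded[OF lim] by (auto simp: bounded_iff)
    have "norm (u n) \<le> M / c" for n
      using c(2)[OF u(2)[of n]] u(1)[of n] M[of n] c(1) by (simp add: field_simps)
    then have "bounded (range u)" by (auto simp: bounded_iff)
    with C obtain l r where r: "strict_mono (r :: nat \<Rightarrow> nat)" "(\<lambda>n. C (u (r n))) \<longlonglongrightarrow> l"
      by (rule compact_mapE)
    have fr: "(\<lambda>n. R (u (r n))) \<longlonglongrightarrow> y"
      using LIMSEQ_subseq_LIMSEQ[OF lim r(1)] u by (simp add: o_def)
    from tendsto_add[OF this r(2)] have "(\<lambda>n. u (r n)) \<longlonglongrightarrow> y + l" by (simp add: R_def)
    from LIMSEQ_unique[OF R.tendsto[OF this] fr] show ?thesis by (rule range_eqI[OF sym])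
  qed
  then show ?thesis unfolding closed_sequential_limits by blast
qed

text \<open>On the kernel of R the operator C is the identity, so an infinite-dimensional kernel
  would contain a separated sequence of unit vectors fixed by C.\<close>

lemma finite_dim_kernel_R: "\<exists>B. finite B \<and> independent B \<and> span B = {x. R x = 0}"
proof -
  define N where "N = {x. R x = 0}"
  have N: "subspace N" unfolding N_def by (rule linear_subspace_kernel[OF R.linear])
  have "\<exists>F. finite F \<and> N \<subseteq> span F"
  proof (rule ccontr)
    assume inf: "\<not> ?thesis"
    have step: "\<exists>u\<in>N. norm u = 1 \<and> (\<forall>z\<in>span F. 1/2 \<le> norm (u - z))" if F: "finite F" "F \<subseteq> N" for F
    proof -
      obtain x where "x \<in> N" "x \<notin> span F" using inf F(1) by blast
      with F N show ?thesis
        by (meson riesz_lemma[OF closed_span_finite subspace_span, of F N x] span_minimal)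
    qed
    \<comment> \<open>The state of the dependent choice is the set F of the vectors chosen earlier
      together with the new vector u.\<close>
    define P where "P = (\<lambda>(n::nat) (F, u). finite F \<and> F \<subseteq> N \<and> u \<in> N \<and> norm u = 1 \<and> (\<forall>z\<in>span F. 1/2 \<le> norm (u - z)))"
    have "\<exists>f. \<forall>n. P n (f n) \<and> fst (f (Suc n)) = insert (snd (f n)) (fst (f n))"
    proof (rule dependent_nat_choice)
      obtain u where "u \<in> N" "norm u = 1" "\<forall>z\<in>span {}. 1/2 \<le> norm (u - z)" using step[of "{}"] by auto
      then show "\<exists>x. P 0 x" by (intro exI[of _ "({}, u)"]) (simp add: P_def)
      fix x n assume x: "P n x"
      then obtain u where "u\<in>N" "norm u = 1" "\<forall>z\<in>span (insert (snd x) (fst x)). 1/2 \<le> norm (u - z)"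
        using step[of "insert (snd x) (fst x)"] by (auto simp: P_def)
      then show "\<exists>y. P (Suc n) y \<and> fst y = insert (snd x) (fst x)"
        using x by (intro exI[of _ "(insert (snd x) (fst x), u)"]) (auto simp: P_def)
    qed
    then obtain f where f: "\<And>n. P n (f n)" "\<And>n. fst (f (Suc n)) = insert (snd (f n)) (fst (f n))" by blast
    define u where "u n = snd (f n)" for n
    have u: "u n \<in> N" "norm (u n) = 1" "\<And>z. z \<in> span (fst (f n)) \<Longrightarrow> 1/2 \<le> norm (u n - z)" for n
      using f(1)[of n] by (auto simp: P_def u_def split: prod.splits)
    have mem: "u m \<in> fst (f n)" if "m < n" for m n
      using that by (induction n) (auto simp: f(2) u_def less_Suc_eq)
    have Cu: "C (u n) = u n" for n using u(1)[of n] by (simp add: N_def R_def)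
    show False
    proof (rule compact_map_not_separated[OF C])
      show "bounded (range u)" using u(2) by (auto simp: bounded_iff intro!: exI[of _ 1])
      show "1/2 \<le> norm (C (u m) - C (u n))" if "m < n" for m n
        unfolding Cu using u(3)[OF span_base[OF mem[OF that]]] by (simp add: norm_minus_commute)
    qed simp
  qed
  then obtain F where F: "finite F" "N \<subseteq> span F" by blast
  obtain B where B: "B \<subseteq> N" "independent B" "N \<subseteq> span B" by (rule maximal_independent_subset)
  have "finite B" using independent_span_bound[OF F(1) B(2)] B(1) F(2) by blast
  moreover have "span B = N" using B N by (simp add: span_minimal subset_antisym)
  ultimately show ?thesis using B by (auto simp: N_def)
qed

text \<open>Powers of R are again the identity minus a compact map, because I - R^(n+1) = (I - R^n)
  + C R^n. Hence the results on kernel and range apply to every power.\<close>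

lemma
  shows R_power_bounded_linear: "bounded_linear (R ^^ n)"
    and R_power_riesz: "riesz (\<lambda>x. x - (R ^^ n) x)"
proof -
  show bl: "bounded_linear (R ^^ n)" for n
    by (induction n) (auto simp: o_def id_def intro: bounded_linear_ident bounded_linear_compose[OF R.bounded_linear_axioms])
  show "riesz (\<lambda>x. x - (R ^^ n) x)"
  proof (induction n)
    case 0
    then show ?case by unfold_locales (simp add: compact_map_zero)
  next
    case (Suc n)
    have "compact_map (\<lambda>x. (x - (R ^^ n) x) + C ((R ^^ n) x))"
      by (intro compact_map_add riesz.C[OF Suc] compact_map_compose_right[OF C] bl)
    moreover have "(\<lambda>x. (x - (R ^^ n) x) + C ((R ^^ n) x)) = (\<lambda>x. x - (R ^^ Suc n) x)"
      by (rule ext) (simp add: R_def[of "(R ^^ n) _"])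
    ultimately show ?case by (simp only: riesz_def)
  qed
qed

lemma riesz_R_power: "riesz.R (\<lambda>x. x - (R ^^ n) x) = R ^^ n"
  by (rule ext) (simp add: riesz.R_def[OF R_power_riesz])

text \<open>If the kernels of the powers grew strictly, Riesz's lemma would give unit vectors u n in
  the kernel of R^(n+1) at distance at least 1/2 from the kernel of R^n. For m < n, C(u m) - C(u n)
  is -u n plus an element of the kernel of R^n, so the images under C would be separated.\<close>

lemma ascent: "\<exists>p. {x. (R ^^ Suc p) x = 0} \<subseteq> {x. (R ^^ p) x = 0}"
proof (rule ccontr)
  assume neg: "\<not> ?thesis"
  define K where "K n = {x. (R ^^ n) x = 0}" for n
  have K: "subspace (K n)" "closed (K n)" for n
  proof -
    interpret Rn: bounded_linear "R ^^ n" by (rule R_power_bounded_linear)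
    show "subspace (K n)" unfolding K_def by (rule linear_subspace_kernel[OF Rn.linear])
    show "closed (K n)"
      unfolding K_def by (intro closed_Collect_eq Rn.continuous_on continuous_intros)
  qed
  have mono: "K m \<subseteq> K n" if "m \<le> n" for m n
    using that by (induction rule: dec_induct) (auto simp: K_def R.zero)
  have RK: "R x \<in> K n" if "x \<in> K (Suc n)" for x n
    using that by (simp add: K_def funpow_swap1)
  have "\<exists>u\<in>K (Suc n). norm u = 1 \<and> (\<forall>z\<in>K n. 1/2 \<le> norm (u - z))" for n
  proof -
    obtain x where "x \<in> K (Suc n)" "x \<notin> K n" using neg unfolding K_def by blast
    then show ?thesis by (meson riesz_lemma[OF K(2) K(1) K(1) mono, of n "Suc n" x] le_SucI order_refl)
  qed
  then obtain u where u: "\<And>n. u n \<in> K (Suc n)" "\<And>n. norm (u n) = 1"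
    "\<And>n z. z \<in> K n \<Longrightarrow> 1/2 \<le> norm (u n - z)" by metis
  show False
  proof (rule compact_map_not_separated[OF C])
    show "bounded (range u)" using u(2) by (auto simp: bounded_iff intro!: exI[of _ 1])
    fix m n :: nat assume mn: "m < n"
    then have um: "u m \<in> K n" using u(1)[of m] mono[of "Suc m" n] by auto
    moreover have "R (u m) \<in> K n" using um RK mono[of n "Suc n"] by auto
    moreover have "R (u n) \<in> K n" using u(1) RK by blast
    ultimately have "R (u n) + (u m - R (u m)) \<in> K n" using K by (blast intro: subspace_add subspace_diff)
    from u(3)[OF this] show "1/2 \<le> norm (C (u m) - C (u n))"
      by (simp add: compact_decomp norm_minus_commute algebra_simps)
  qed simp
qed

text \<open>The same argument along the decreasing ranges. Riesz's lemma asks for closed subspaces,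
  which \<open>closed_range_R\<close> supplies for every power of R.\<close>

lemma descent: "\<exists>q. range (R ^^ q) \<subseteq> range (R ^^ Suc q)"
proof (rule ccontr)
  assume neg: "\<not> ?thesis"
  define Q where "Q n = range (R ^^ n)" for n
  have Q: "subspace (Q n)" "closed (Q n)" for n
  proof -
    interpret Rn: bounded_linear "R ^^ n" by (rule R_power_bounded_linear)
    show "subspace (Q n)" unfolding Q_def by (intro linear_subspace_image[OF Rn.linear] subspace_UNIV)
    show "closed (Q n)" unfolding Q_def
      using riesz.closed_range_R[OF R_power_riesz, of n] by (simp only: riesz_R_power)
  qed
  have RQ: "R x \<in> Q (Suc n)" if "x \<in> Q n" for x n
    using that by (auto simp: Q_def)
  have mono: "Q n \<subseteq> Q m" if "m \<le> n" for m n
    using that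
  proof (induction rule: dec_induct)
    case (step n)
    have "Q (Suc n) \<subseteq> Q n" unfolding Q_def by (simp add: funpow_Suc_right del: funpow.simps) blast
    then show ?case using step by blast
  qed simp
  have "\<exists>u\<in>Q n. norm u = 1 \<and> (\<forall>z\<in>Q (Suc n). 1/2 \<le> norm (u - z))" for n
  proof -
    obtain x where "x \<in> Q n" "x \<notin> Q (Suc n)" using neg unfolding Q_def by blast
    then show ?thesis by (meson riesz_lemma[OF Q(2) Q(1) Q(1) mono, of n "Suc n" x] le_SucI order_refl)
  qed
  then obtain u where u: "\<And>n. u n \<in> Q n" "\<And>n. norm (u n) = 1"
    "\<And>n z. z \<in> Q (Suc n) \<Longrightarrow> 1/2 \<le> norm (u n - z)" by metis
  show False
  proof (rule compact_map_not_separated[OF C])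
    show "bounded (range u)" using u(2) by (auto simp: bounded_iff intro!: exI[of _ 1])
    fix m n :: nat assume mn: "m < n"
    then have "u n \<in> Q (Suc m)" "R (u n) \<in> Q (Suc m)"
      using u(1)[of n] RQ mono[of "Suc m" n] mono[of "Suc m" "Suc n"] by auto
    moreover have "R (u m) \<in> Q (Suc m)" using u(1) RQ by blast
    ultimately have "R (u m) + (u n - R (u n)) \<in> Q (Suc m)"
      using Q by (blast intro: subspace_add subspace_diff)
    from u(3)[OF this] show "1/2 \<le> norm (C (u m) - C (u n))"
      by (simp add: compact_decomp algebra_simps)
  qed simp
qed

lemma kernel_power_stable:
  assumes "{x. (R ^^ Suc p) x = 0} \<subseteq> {x. (R ^^ p) x = 0}" "p \<le> n" "(R ^^ Suc n) x = 0"
  shows "(R ^^ n) x = 0"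
  using assms(2,3)
proof (induction arbitrary: x rule: dec_induct)
  case base
  then show ?case using assms(1) by blast
next
  case (step n)
  have "(R ^^ Suc n) (R x) = 0" using step.prems by (simp add: funpow_swap1)
  then have "(R ^^ n) (R x) = 0" by (rule step.IH)
  then show ?case by (simp add: funpow_swap1)
qed

lemma range_power_stable:
  assumes "range (R ^^ q) \<subseteq> range (R ^^ Suc q)" "q \<le> n"
  shows "range (R ^^ n) \<subseteq> range (R ^^ Suc n)"
  using assms(2)
proof (induction rule: dec_induct)
  case (step n)
  have "(R ^^ Suc n) x \<in> range (R ^^ Suc (Suc n))" for x
  proof -
    obtain z where "(R ^^ n) x = (R ^^ Suc n) z" using step.IH by blast
    then have "(R ^^ Suc n) x = (R ^^ Suc (Suc n)) z" by simp
    then show ?thesis by blast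
  qed
  then show ?case by blast
qed (rule assms(1))

text \<open>Beyond ascent and descent, R^k y = R^(2k) z for some z, so y - R^k z lies in the kernel
  of R^k. This reduces the cokernel of R to the finite-dimensional kernel of R^k.\<close>

lemma fitting_decomposition:
  obtains k where "\<And>x. (R ^^ Suc k) x = 0 \<Longrightarrow> (R ^^ k) x = 0"
    "\<And>y. \<exists>m z. y = m + R z \<and> (R ^^ k) m = 0"
proof -
  obtain p where p: "{x. (R ^^ Suc p) x = 0} \<subseteq> {x. (R ^^ p) x = 0}" using ascent by blast
  obtain q where q: "range (R ^^ q) \<subseteq> range (R ^^ Suc q)" using descent by blast
  \<comment> \<open>The successor makes k positive, so that R^k z lies in the range of R.\<close>
  define k where "k = Suc (max p q)"
  interpret Rk: bounded_linear "R ^^ k" by (rule R_power_bounded_linear)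
  have "range (R ^^ k) \<subseteq> range (R ^^ (k + j))" for j
  proof (induction j)
    case (Suc j)
    have "range (R ^^ (k + j)) \<subseteq> range (R ^^ Suc (k + j))"
      by (rule range_power_stable[OF q]) (simp add: k_def)
    with Suc show ?case by simp
  qed simp
  then have kk: "range (R ^^ k) \<subseteq> range (R ^^ (k + k))" .
  have "\<exists>m z. y = m + R z \<and> (R ^^ k) m = 0" for y
  proof -
    obtain z where "(R ^^ k) y = (R ^^ (k + k)) z" using kk by blast
    then have "(R ^^ k) (y - (R ^^ k) z) = 0" by (simp add: Rk.diff funpow_add)
    moreover have "y = (y - (R ^^ k) z) + R ((R ^^ max p q) z)" by (simp add: k_def)
    ultimately show ?thesis by blast
  qed
  moreover have "(R ^^ k) x = 0" if "(R ^^ Suc k) x = 0" for x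
    by (rule kernel_power_stable[OF p _ that]) (simp add: k_def)
  ultimately show thesis using that by blast
qed

end

section \<open>Linear algebra on a finite-dimensional invariant subspace\<close>

lemma independent_Un_eq_0:
  assumes ind: "independent (A \<union> B)" and disj: "A \<inter> B = {}" and x: "x \<in> span A" "x \<in> span B"
  shows "x = 0"
proof -
  obtain t r where t: "finite t" "t \<subseteq> A" "x = (\<Sum>a\<in>t. r a *\<^sub>R a)" using x(1) by (auto simp: span_explicit)
  obtain s q where s: "finite s" "s \<subseteq> B" "x = (\<Sum>a\<in>s. q a *\<^sub>R a)" using x(2) by (auto simp: span_explicit)
  define u where "u a = (if a \<in> t then r a else - q a)" for a
  have ts: "t \<inter> s = {}" using t s disj by blast
  have "(\<Sum>a\<in>t \<union> s. u a *\<^sub>R a) = (\<Sum>a\<in>t. u a *\<^sub>R a) + (\<Sum>a\<in>s. u a *\<^sub>R a)"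
    by (rule sum.union_disjoint[OF t(1) s(1) ts])
  also have "(\<Sum>a\<in>t. u a *\<^sub>R a) = x" unfolding t(3) by (intro sum.cong) (auto simp: u_def)
  also have "(\<Sum>a\<in>s. u a *\<^sub>R a) = - x"
    unfolding s(3) sum_negf[symmetric] using ts by (intro sum.cong) (auto simp: u_def)
  finally have "(\<Sum>a\<in>t \<union> s. u a *\<^sub>R a) = 0" by simp
  then have "u a = 0" if "a \<in> t" for a
    using that t s by (intro independentD[OF ind, of "t \<union> s" u a]) auto
  then have "r a = 0" if "a \<in> t" for a using that by (auto simp: u_def)
  then show "x = 0" unfolding t(3) by simp
qed

text \<open>Rank and nullity: B is extended to a basis B' of M, and the image E of B' - B, a basis
  of T(M), is extended to a basis E' of M. Both bases have the same size, so D = E' - E is as large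
  as B.\<close>

lemma finite_dim_endo_cokernel:
  fixes T :: "'a::real_vector \<Rightarrow> 'a"
  assumes T: "linear T" and M: "subspace M" "T ` M \<subseteq> M" "finite F" "M \<subseteq> span F"
    and B: "finite B" "independent B" "span B = {x. T x = 0}" "B \<subseteq> M"
  obtains D where "finite D" "independent D" "card D = card B" "D \<subseteq> M"
    "\<And>x. x \<in> T ` M \<Longrightarrow> x \<in> span D \<Longrightarrow> x = 0"
    "\<And>y. y \<in> M \<Longrightarrow> \<exists>x\<in>M. \<exists>d\<in>span D. y = T x + d"
proof -
  obtain B' where B': "B \<subseteq> B'" "B' \<subseteq> M" "independent B'" "M \<subseteq> span B'"
    using maximal_independent_subset_extend[OF B(4,2)] .
  have spB': "span B' = M" using B' M(1) by (simp add: span_minimal subset_antisym)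
  have finB': "finite B'" using independent_span_bound[OF M(3) B'(3)] B'(2) M(4) by blast
  have indB'': "independent (B' - B)" using B'(3) independent_mono by blast
  have Bun: "B' = B \<union> (B' - B)" using B' by blast
  have inj: "inj_on T (span (B' - B))"
  proof (rule inj_onI)
    fix x y assume xy: "x \<in> span (B' - B)" "y \<in> span (B' - B)" "T x = T y"
    then have "x - y \<in> span B" by (simp add: B(3) linear_diff[OF T])
    moreover have "x - y \<in> span (B' - B)" using xy by (intro span_diff)
    ultimately have "x - y = 0"
      using independent_Un_eq_0[of B "B' - B" "x - y"] B'(3) Bun by auto
    then show "x = y" by simp
  qed
  define E where "E = T ` (B' - B)"
  have indE: "independent E" unfolding E_def by (rule linear_independent_injective_image[OF T indB'' inj])
  have cardE: "card E = card B' - card B"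
    unfolding E_def using card_image[OF inj_on_subset[OF inj span_superset]] B'(1) B(1) by (simp add: card_Diff_subset)
  have EM: "E \<subseteq> M" using B'(2) M(2) unfolding E_def by blast
  have spE: "span E = T ` M"
  proof
    show "span E \<subseteq> T ` M" unfolding E_def linear_span_image[OF T]
      using span_mono[of "B' - B" B'] spB' by blast
    have "T ` B \<subseteq> {0}" using B(3) span_superset[of B] by auto
    then have "T ` B' \<subseteq> insert 0 E" by (auto simp: E_def)
    then have "T ` B' \<subseteq> span E" by (meson insert_subset order_trans span_superset span_zero)
    then show "T ` M \<subseteq> span E"
      unfolding spB'[symmetric] linear_span_image[OF T, symmetric] by (simp add: span_minimal)
  qed
  obtain E' where E': "E \<subseteq> E'" "E' \<subseteq> M" "independent E'" "M \<subseteq> span E'"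
    using maximal_independent_subset_extend[OF EM indE] .
  have spE': "span E' = M" using E' M(1) by (simp add: span_minimal subset_antisym)
  have finE': "finite E'" using independent_span_bound[OF M(3) E'(3)] E'(2) M(4) by blast
  have Eun: "E' = E \<union> (E' - E)" using E' by blast
  have "card E' = card B'" using dim_eq_card_independent[OF E'(3)] dim_eq_card_independent[OF B'(3)]
    spE' spB' by (metis dim_span)
  then have "card (E' - E) = card B"
    using cardE card_mono[OF finB' B'(1)] E' finite_subset[OF E'(1) finE'] by (simp add: card_Diff_subset)
  moreover have "x = 0" if "x \<in> T ` M" "x \<in> span (E' - E)" for x
    using independent_Un_eq_0[of E "E' - E" x] E'(3) Eun that spE by auto
  moreover have "\<exists>x\<in>M. \<exists>d\<in>span (E' - E). y = T x + d" if "y \<in> M" for y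
  proof -
    have "y \<in> span (E \<union> (E' - E))" using that spE' Eun by simp
    then obtain e d where "y = e + d" "e \<in> span E" "d \<in> span (E' - E)" unfolding span_Un by blast
    moreover from this obtain x where "x \<in> M" "e = T x" using spE by blast
    ultimately show ?thesis by (intro bexI[of _ x] bexI[of _ d]) auto
  qed
  moreover have "finite (E' - E)" "E' - E \<subseteq> M" using finE' E'(2) by auto
  moreover have "independent (E' - E)" by (rule independent_mono[OF E'(3)]) simp
  ultimately show thesis by (intro that[of "E' - E"])
qed

section \<open>Compact perturbations of Fredholm operators of index zero\<close>

text \<open>Passes from a basis given as a set to the indexed coefficients by which
  \<open>fredholm0\<close> describes a complement of the range.\<close>

lemma enumerated_basis:
  fixes D :: "'a::real_vector set"
  assumes D: "finite D" "independent D"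
  obtains b :: "nat \<Rightarrow> 'a" where "bij_betw b {..<card D} D"
    "\<And>c. (\<Sum>i<card D. c i *\<^sub>R b i) \<in> span D"
    "\<And>c i. (\<Sum>i<card D. c i *\<^sub>R b i) = 0 \<Longrightarrow> i < card D \<Longrightarrow> c i = 0"
    "\<And>d. d \<in> span D \<Longrightarrow> \<exists>c. d = (\<Sum>i<card D. c i *\<^sub>R b i)"
proof -
  obtain b where b: "bij_betw b {..<card D} D"
    using ex_bij_betw_nat_finite[OF D(1)] by (auto simp: atLeast0LessThan)
  define a where "a = the_inv_into {..<card D} b"
  have ab: "a (b i) = i" if "i < card D" for i
    using b that by (simp add: a_def bij_betw_def the_inv_into_f_f)
  have sum: "(\<Sum>i<card D. c i *\<^sub>R b i) = (\<Sum>v\<in>D. c (a v) *\<^sub>R v)" for c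
    using sum.reindex_bij_betw[OF b, of "\<lambda>v. c (a v) *\<^sub>R v"] by (simp add: ab)
  show thesis
  proof (rule that[OF b])
    fix c
    show "(\<Sum>i<card D. c i *\<^sub>R b i) \<in> span D"
      unfolding sum by (intro span_sum span_scale span_base)
    fix i
    assume 0: "(\<Sum>i<card D. c i *\<^sub>R b i) = 0" and i: "i < card D"
    have "b i \<in> D" using b i by (auto simp: bij_betw_def)
    then have "c (a (b i)) = 0"
      using independentD[OF D(2,1) order_refl, of "\<lambda>v. c (a v)"] 0 unfolding sum by blast
    then show "c i = 0" by (simp add: ab[OF i])
  next
    fix d assume "d \<in> span D"
    then obtain u where "d = (\<Sum>v\<in>D. u v *\<^sub>R v)" using span_finite[OF D(1)] by auto
    also have "\<dots> = (\<Sum>i<card D. u (b i) *\<^sub>R b i)"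
      by (rule sum.reindex_bij_betw[OF b, symmetric])
    finally show "\<exists>c. d = (\<Sum>i<card D. c i *\<^sub>R b i)" by (intro exI[of _ "\<lambda>i. u (b i)"])
  qed
qed

context riesz
begin

text \<open>The kernel M of R^k is finite-dimensional, invariant under R and contains the kernel of
  R. Since the whole space is M plus the range of R, a complement D of R(M) in M is also a
  complement of the range of R, and its dimension is that of the kernel.\<close>

lemma fredholm0_R: "fredholm0 R"
proof -
  obtain B where B: "finite B" "independent B" "span B = {x. R x = 0}" using finite_dim_kernel_R by blast
  obtain k where k: "\<And>x. (R ^^ Suc k) x = 0 \<Longrightarrow> (R ^^ k) x = 0"
    "\<And>y. \<exists>m z. y = m + R z \<and> (R ^^ k) m = 0" using fitting_decomposition by blast
  interpret Rk: bounded_linear "R ^^ k" by (rule R_power_bounded_linear)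
  define M where "M = {x. (R ^^ k) x = 0}"
  have M: "subspace M" unfolding M_def by (rule linear_subspace_kernel[OF Rk.linear])
  have "\<exists>F. finite F \<and> independent F \<and> span F = M"
    using riesz.finite_dim_kernel_R[OF R_power_riesz, of k] unfolding riesz_R_power M_def .
  then obtain F where F: "finite F" "M \<subseteq> span F" by blast
  have RM: "R ` M \<subseteq> M"
  proof (rule image_subsetI)
    fix x assume "x \<in> M"
    then have "R ((R ^^ k) x) = 0" by (simp add: M_def R.zero)
    then show "R x \<in> M" by (simp add: M_def funpow_swap1)
  qed
  have BM: "B \<subseteq> M"
  proof
    fix x assume "x \<in> B"
    then have "R x = 0" using B(3) span_base[of x B] by auto
    then have "(R ^^ Suc k) x = 0" by (simp only: funpow_Suc_right o_def Rk.zero)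
    then show "x \<in> M" unfolding M_def using k(1) by blast
  qed
  obtain D where D: "finite D" "independent D" "card D = card B" "D \<subseteq> M"
    "\<And>x. x \<in> R ` M \<Longrightarrow> x \<in> span D \<Longrightarrow> x = 0"
    "\<And>y. y \<in> M \<Longrightarrow> \<exists>x\<in>M. \<exists>d\<in>span D. y = R x + d"
    by (rule finite_dim_endo_cokernel[OF R.linear M RM F B BM]) (rule that; blast)
  obtain b where b: "\<And>c. (\<Sum>i<card B. c i *\<^sub>R b i) \<in> span D"
    "\<And>c i. (\<Sum>i<card B. c i *\<^sub>R b i) = 0 \<Longrightarrow> i < card B \<Longrightarrow> c i = 0"
    "\<And>d. d \<in> span D \<Longrightarrow> \<exists>c. d = (\<Sum>i<card B. c i *\<^sub>R b i)"
    using enumerated_basis[OF D(1,2)] unfolding D(3) by metis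
  have "c i = 0" if c: "(\<Sum>i<card B. c i *\<^sub>R b i) \<in> range R" and i: "i < card B" for c i
  proof -
    obtain x where x: "(\<Sum>i<card B. c i *\<^sub>R b i) = R x" using c by blast
    \<comment> \<open>A value R x in the span of D lies in M, so R^(k+1) x = 0 and x itself lies in
      M by stability of the kernels; then R x lies in R(M) and in the span of D, hence
      vanishes.\<close>
    have "R x \<in> M" using b(1)[of c] D(4) M x span_minimal by (metis subsetD)
    then have "(R ^^ Suc k) x = 0" by (simp only: funpow_Suc_right o_def M_def mem_Collect_eq)
    then have "x \<in> M" unfolding M_def using k(1) by blast
    then have "R x = 0" using D(5)[of "R x"] b(1)[of c] x by auto
    then show ?thesis using b(2) i x by simp
  qed
  moreover have "\<exists>x c. y = R x + (\<Sum>i<card B. c i *\<^sub>R b i)" for y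
  proof -
    obtain m z where y: "y = m + R z" "m \<in> M" using k(2)[of y] by (auto simp: M_def)
    obtain x d where x: "m = R x + d" "d \<in> span D" using D(6)[OF y(2)] by blast
    obtain c where "d = (\<Sum>i<card B. c i *\<^sub>R b i)" using b(3)[OF x(2)] by blast
    then have "y = R (x + z) + (\<Sum>i<card B. c i *\<^sub>R b i)" using x y by (simp add: R.add)
    then show ?thesis by blast
  qed
  ultimately show ?thesis unfolding fredholm0_def
    using R.bounded_linear_axioms closed_range_R B by blast
qed

end

lemma fredholm0_compose_bij:
  fixes A :: "'b::banach \<Rightarrow> 'c::banach" and R :: "'a::real_normed_vector \<Rightarrow> 'b"
  assumes A: "bounded_linear A" "bij A" and R: "fredholm0 R"
  shows "fredholm0 (\<lambda>x. A (R x))"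
proof -
  interpret A: bounded_linear A by fact
  have iA: "bounded_linear (inv A)" by (rule bounded_linear_inv[OF A])
  have [simp]: "A x = A y \<longleftrightarrow> x = y" for x y using bij_is_inj[OF A(2)] by (simp add: inj_eq)
  have [simp]: "A (inv A y) = y" for y using bij_is_surj[OF A(2)] by (simp add: surj_f_inv_f)
  have A0: "A x = 0 \<longleftrightarrow> x = 0" for x using A.zero by (metis \<open>\<And>y x. (A x = A y) = (x = y)\<close>)
  obtain B b where R': "bounded_linear R" "closed (range R)" and B: "finite B" "independent B" "span B = {x. R x = 0}"
    and b: "\<And>c. (\<Sum>i<card B. c i *\<^sub>R b i) \<in> range R \<Longrightarrow> (\<forall>i<card B. c i = 0)"
    "\<And>y. \<exists>x c. y = R x + (\<Sum>i<card B. c i *\<^sub>R b i)"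
    using R unfolding fredholm0_def by blast
  have sumA: "(\<Sum>i<card B. c i *\<^sub>R A (b i)) = A (\<Sum>i<card B. c i *\<^sub>R b i)" for c
    by (simp add: A.sum A.scaleR)
  have "range (\<lambda>x. A (R x)) = inv A -` range R"
  proof (intro set_eqI iffI)
    fix y assume "y \<in> inv A -` range R"
    then obtain x where "inv A y = R x" by auto
    then have "y = A (R x)" by (metis \<open>\<And>y. A (inv A y) = y\<close>)
    then show "y \<in> range (\<lambda>x. A (R x))" by blast
  qed (auto simp: inv_f_f[OF bij_is_inj[OF A(2)]])
  then have "closed (range (\<lambda>x. A (R x)))"
    using closed_vimage[OF R'(2) linear_continuous_on[OF iA]] by simp
  moreover have "c i = 0" if c: "(\<Sum>i<card B. c i *\<^sub>R A (b i)) \<in> range (\<lambda>x. A (R x))" "i < card B" for c i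
  proof -
    have "(\<Sum>i<card B. c i *\<^sub>R b i) \<in> range R" using c(1) unfolding sumA by auto
    then show ?thesis using b(1) c(2) by blast
  qed
  moreover have "\<exists>x c. y = A (R x) + (\<Sum>i<card B. c i *\<^sub>R A (b i))" for y
  proof -
    obtain x c where "inv A y = R x + (\<Sum>i<card B. c i *\<^sub>R b i)" using b(2) by blast
    then have "A (inv A y) = A (R x) + A (\<Sum>i<card B. c i *\<^sub>R b i)" by (simp only: A.add)
    then show ?thesis unfolding sumA by auto
  qed
  moreover have "span B = {x. A (R x) = 0}" using B(3) by (simp add: A0)
  moreover have "bounded_linear (\<lambda>x. A (R x))" by (rule bounded_linear_compose[OF A(1) R'(1)])
  ultimately show ?thesis unfolding fredholm0_def
    using B(1,2) by (intro conjI exI[of _ B] exI[of _ "\<lambda>i. A (b i)"]) auto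
qed

text \<open>F maps the i-th basis vector of the kernel to the i-th vector of a complement of the
  range; index zero means that their numbers agree.\<close>

lemma fredholm0_finite_rank_bij:
  fixes T :: "'a::real_normed_vector \<Rightarrow> 'b::real_normed_vector"
  assumes "fredholm0 T"
  obtains F where "compact_map F" "bij (\<lambda>x. T x + F x)"
proof -
  obtain B b where T: "bounded_linear T" and B: "finite B" "independent B" "span B = {x. T x = 0}"
    and b: "\<And>c. (\<Sum>i<card B. c i *\<^sub>R b i) \<in> range T \<Longrightarrow> (\<forall>i<card B. c i = 0)"
    "\<And>y. \<exists>x c. y = T x + (\<Sum>i<card B. c i *\<^sub>R b i)"
    using assms unfolding fredholm0_def by blast
  interpret T: bounded_linear T by fact
  obtain e where e: "bij_betw e {..<card B} B" "\<And>d. d \<in> span B \<Longrightarrow> \<exists>c. d = (\<Sum>i<card B. c i *\<^sub>R e i)"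
    using enumerated_basis[OF B(1,2)] by metis
  obtain f where f: "\<And>v. v \<in> B \<Longrightarrow> bounded_linear (f v)"
    "\<And>v v'. v \<in> B \<Longrightarrow> v' \<in> B \<Longrightarrow> f v v' = (if v = v' then 1 else 0 :: real)"
    using dual_basis[OF B(1,2)] by metis
  have eB: "e i \<in> B" if "i < card B" for i using e(1) that by (auto simp: bij_betw_def)
  have inj: "e i = e j \<longleftrightarrow> i = j" if "i < card B" "j < card B" for i j
    using e(1) that by (auto simp: bij_betw_def inj_on_eq_iff)
  have blf: "bounded_linear (f (e i))" if "i < card B" for i using f(1) eB that by blast
  have fsum: "f (e i) (\<Sum>j<card B. c j *\<^sub>R e j) = c i" if i: "i < card B" for c i
  proof -
    interpret fi: bounded_linear "f (e i)" by (rule blf[OF i])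
    have "f (e i) (\<Sum>j<card B. c j *\<^sub>R e j) = (\<Sum>j<card B. c j * (if i = j then 1 else 0))"
      using i by (simp add: fi.sum fi.scaleR f(2) eB inj)
    then show ?thesis using i by (simp add: if_distrib cong: if_cong)
  qed
  define F where "F x = (\<Sum>i<card B. f (e i) x *\<^sub>R b i)" for x
  have F: "compact_map F" unfolding F_def by (rule compact_map_finite_rank) (simp add: blf)
  interpret F: bounded_linear F by (rule compact_map_bounded_linear[OF F])
  let ?A = "\<lambda>x. T x + F x"
  have linA: "linear ?A" by (intro linear_compose_add T.linear F.linear)
  have "x = 0" if "?A x = 0" for x
  proof -
    have "F x = T (- x)" using that by (simp add: T.neg eq_neg_iff_add_eq_0 add.commute)
    then have 0: "f (e i) x = 0" if "i < card B" for i
      using b(1)[of "\<lambda>i. f (e i) x"] that by (auto simp: F_def)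
    then have "F x = 0" by (simp add: F_def)
    then have "x \<in> span B" using that B(3) by simp
    then obtain c where c: "x = (\<Sum>i<card B. c i *\<^sub>R e i)" using e(2) by blast
    have "c i = 0" if "i < card B" for i using 0[OF that] fsum[OF that, of c] c by simp
    then show "x = 0" using c by simp
  qed
  then have "inj ?A" using linear_injective_0[OF linA] by blast
  moreover have "\<exists>x. y = ?A x" for y
  proof -
    obtain x c where y: "y = T x + (\<Sum>i<card B. c i *\<^sub>R b i)" using b(2) by blast
    \<comment> \<open>A correction in the kernel of T: it leaves T x unchanged and moves the kernel
      coordinates of x to the prescribed values c.\<close>
    define z where "z = (\<Sum>j<card B. (c j - f (e j) x) *\<^sub>R e j)"
    have "z \<in> span B" unfolding z_def using eB by (intro span_sum span_scale span_base) auto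
    then have "T z = 0" using B(3) by blast
    moreover have "f (e i) (x + z) = c i" if "i < card B" for i
      using fsum[OF that, of "\<lambda>j. c j - f (e j) x"] linear_add[OF bounded_linear.linear[OF blf[OF that]]]
      by (simp add: z_def)
    then have "F (x + z) = (\<Sum>i<card B. c i *\<^sub>R b i)" unfolding F_def by (intro sum.cong) auto
    ultimately have "y = ?A (x + z)" using y by (simp add: T.add)
    then show ?thesis by blast
  qed
  then have "surj ?A" by (metis surj_def)
  ultimately show thesis using that[OF F] by (simp add: bij_def)
qed

theorem fredholm0_add_compact:
  fixes T K :: "'a::banach \<Rightarrow> 'b::banach"
  assumes T: "fredholm0 T" and K: "compact_map K"
  shows "fredholm0 (\<lambda>x. T x + K x)"
proof -
  obtain F where F: "compact_map F" "bij (\<lambda>x. T x + F x)" using fredholm0_finite_rank_bij[OF T] .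
  define A where "A = (\<lambda>x. T x + F x)"
  have A: "bounded_linear A" "bij A"
    using T F unfolding A_def fredholm0_def by (auto intro: bounded_linear_add compact_map_bounded_linear)
  interpret A: bounded_linear A by fact
  \<comment> \<open>The choice is dictated by A(I - C) = A - (F - K) = T + K.\<close>
  define C where "C = (\<lambda>x. inv A (F x - K x))"
  have "compact_map C" unfolding C_def
    by (intro compact_map_compose_left[OF _ bounded_linear_inv[OF A]] compact_map_diff F K)
  then interpret riesz C by unfold_locales
  have "A (R x) = T x + K x" for x
  proof -
    have "A (C x) = F x - K x" unfolding C_def using bij_is_surj[OF A(2)] by (simp add: surj_f_inv_f)
    moreover have "A (R x) = A x - A (C x)" by (simp add: R_def A.diff)
    ultimately show ?thesis by (simp add: A_def)
  qed
  then show ?thesis using fredholm0_compose_bij[OF A fredholm0_R] by simp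
qed

section \<open>Derivatives and functionals on subspaces\<close>

text \<open>The projection P only serves to extend the derivative, which analyticity gives on S, to
  the whole space.\<close>
lemma analytic_sub_has_derivative:
  fixes f :: "'a::real_normed_vector \<Rightarrow> 'b::banach"
  assumes an: "analytic_sub S D f" and S: "subspace S" and x: "x \<in> D" "x \<in> S"
    and P: "bounded_linear P" "\<And>v. P v \<in> S" "\<And>v. v \<in> S \<Longrightarrow> P v = v"
  shows "\<exists>L. (f has_derivative L) (at x within S)"
proof -
  from bspec[OF an[unfolded analytic_sub_def] x(1)]
  obtain r A M where r: "0 < r" and MA: "\<forall>k. M k \<ge> 0 \<and> multilin_bdd S k (A k) (M k)"
    and sm: "summable (\<lambda>k. M k * r ^ k)"
    and fD: "\<forall>h\<in>S. norm h < r \<longrightarrow> x + h \<in> D \<and> (\<lambda>k. A k (replicate k h)) sums f (x + h)"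
    by (elim exE conjE) (rule that)
  from MA fD have M: "\<And>k. 0 \<le> M k" and A: "\<And>k. multilin_bdd S k (A k) (M k)"
    and f: "\<And>h. h \<in> S \<Longrightarrow> norm h < r \<Longrightarrow> (\<lambda>k. A k (replicate k h)) sums f (x + h)"
    by simp_all
  interpret P: bounded_linear P by fact
  have S0: "0 \<in> S" by (rule subspace_0[OF S])
  have bound: "norm (A k (replicate k h)) \<le> M k * norm h ^ k" if "h \<in> S" for k h
  proof -
    have "length (replicate k h) = k \<and> set (replicate k h) \<subseteq> S" using that by (simp add: set_replicate_conv_if)
    with A[of k] have "norm (A k (replicate k h)) \<le> M k * prod_list (map norm (replicate k h))"
      unfolding multilin_bdd_def by blast
    then show ?thesis by simp
  qed
  \<comment> \<open>Multilinearity is stated through list updates; in degree one the only entry of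
    \<open>[0]\<close> is overwritten, which gives linearity of the first-order term.\<close>
  have lin: "A 1 [a + b] = A 1 [a] + A 1 [b]" "A 1 [c *\<^sub>R a] = c *\<^sub>R A 1 [a]"
    if "a \<in> S" "b \<in> S" for a b c
    using A[of 1] that S0 unfolding multilin_bdd_def by (auto dest!: spec[of _ "[0]"])
  define L where "L v = A 1 [P v]" for v
  have L: "bounded_linear L"
  proof (rule bounded_linear_intro)
    show "L (u + v) = L u + L v" "L (c *\<^sub>R u) = c *\<^sub>R L u" for u v c
      using lin(1)[OF P(2) P(2)] lin(2)[OF P(2) P(2)] by (simp_all add: L_def P.add P.scaleR)
    fix v
    have "norm (L v) \<le> M 1 * norm (P v)" using bound[OF P(2), of 1 v] by (simp add: L_def)
    also have "\<dots> \<le> M 1 * (norm v * onorm P)"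
      using onorm[OF P(1), of v] M[of 1] by (intro mult_left_mono) (simp_all add: mult.commute)
    finally show "norm (L v) \<le> norm v * (M 1 * onorm P)" by (simp add: ac_simps)
  qed
  have fx: "A 0 [] = f x"
  proof -
    have "A k (replicate k 0) = 0" if "k \<noteq> 0" for k using bound[OF S0, of k] that by (simp add: power_0_left)
    then have "(\<lambda>k. A k (replicate k 0)) sums (\<Sum>k\<in>{0}. A k (replicate k 0))"
      by (intro sums_finite) auto
    then show ?thesis using sums_unique2[OF _ f[OF S0]] r by simp
  qed
  \<comment> \<open>Terms of degree at least two at h are at most (|h| / r)^2 times their bounds at
    radius r, so c |h|^2 bounds the whole remainder.\<close>
  define c where "c = (\<Sum>k. M (k + 2) * r ^ (k + 2)) / r\<^sup>2"
  have sm2: "summable (\<lambda>k. M (k + 2) * r ^ (k + 2))" using summable_ignore_initial_segment[OF sm] .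
  have c: "0 \<le> c" unfolding c_def using M r by (intro divide_nonneg_nonneg suminf_nonneg sm2) auto
  have rem: "norm (f (x + h) - f x - L h) \<le> c * (norm h)\<^sup>2" if h: "h \<in> S" "norm h < r" for h
  proof -
    have "(\<lambda>k. A (k + 2) (replicate (k + 2) h)) sums (f (x + h) - (\<Sum>k<2. A k (replicate k h)))"
      by (rule sums_split_initial_segment[OF f[OF h]])
    also have "(\<Sum>k<2. A k (replicate k h)) = f x + L h"
      using P(3)[OF h(1)] fx by (simp add: L_def numeral_2_eq_2)
    finally have sums: "(\<lambda>k. A (k + 2) (replicate (k + 2) h)) sums (f (x + h) - f x - L h)"
      by (simp add: diff_diff_eq)
    have bnd: "norm (A (k + 2) (replicate (k + 2) h)) \<le> (norm h / r)\<^sup>2 * (M (k + 2) * r ^ (k + 2))" for k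
    proof -
      have "norm h ^ k \<le> r ^ k" using h by (intro power_mono) auto
      then have "M (k + 2) * (norm h)\<^sup>2 * norm h ^ k \<le> M (k + 2) * (norm h)\<^sup>2 * r ^ k"
        using M by (intro mult_left_mono) auto
      moreover have "norm (A (k + 2) (replicate (k + 2) h)) \<le> M (k + 2) * norm h ^ (k + 2)"
        by (rule bound[OF h(1)])
      moreover have "M (k + 2) * norm h ^ (k + 2) = M (k + 2) * (norm h)\<^sup>2 * norm h ^ k"
        by (simp add: power_add power2_eq_square ac_simps)
      moreover have "(norm h / r)\<^sup>2 * (M (k + 2) * r ^ (k + 2)) = M (k + 2) * (norm h)\<^sup>2 * r ^ k"
        using r by (simp add: power_divide power_add power2_eq_square ac_simps)
      ultimately show ?thesis by linarith
    qed
    have smn: "summable (\<lambda>k. (norm h / r)\<^sup>2 * (M (k + 2) * r ^ (k + 2)))" using sm2 by (rule summable_mult)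
    have "norm (f (x + h) - f x - L h) \<le> (\<Sum>k. (norm h / r)\<^sup>2 * (M (k + 2) * r ^ (k + 2)))"
      by (rule norm_sums_le[OF sums summable_sums[OF smn] bnd])
    also have "\<dots> = c * (norm h)\<^sup>2" unfolding suminf_mult[OF sm2] c_def by (simp add: power_divide)
    finally show ?thesis .
  qed
  have "(f has_derivative L) (at x within S)"
    unfolding has_derivative_within_alt
  proof (intro conjI allI impI L)
    fix e :: real assume e: "0 < e"
    show "\<exists>d>0. \<forall>y\<in>S. norm (y - x) < d \<longrightarrow> norm (f y - f x - L (y - x)) \<le> e * norm (y - x)"
    \<comment> \<open>Dividing by c + 1 instead of c covers the case c = 0.\<close>
    proof (intro exI[of _ "min r (e / (c + 1))"] conjI ballI impI)
      show "0 < min r (e / (c + 1))" using r e c by simp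
      fix y assume y: "y \<in> S" "norm (y - x) < min r (e / (c + 1))"
      have yS: "y - x \<in> S"
        using y x(2) by (intro subspace_diff[OF S])
      have "(c + 1) * norm (y - x) \<le> e" using y c by (simp add: field_simps)
      moreover have "c * norm (y - x) \<le> (c + 1) * norm (y - x)" by (intro mult_right_mono) auto
      ultimately have "c * norm (y - x) \<le> e" by linarith
      have "norm (f y - f x - L (y - x)) \<le> c * (norm (y - x))\<^sup>2"
        using rem[OF yS] y by simp
      also have "\<dots> = c * norm (y - x) * norm (y - x)" by (simp add: power2_eq_square)
      also have "\<dots> \<le> e * norm (y - x)" by (intro mult_right_mono) (fact, simp)
      finally show "norm (f y - f x - L (y - x)) \<le> e * norm (y - x)" .
    qed
  qed
  then show ?thesis by blast
qed

text \<open>A derivative within S is determined only in directions of S. Along the line x + t v,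
  which stays in S and for small t in W, it becomes a derivative on the real line, where uniqueness
  applies.\<close>

lemma derivative_vanishes:
  fixes f :: "'a::real_normed_vector \<Rightarrow> 'b::real_normed_vector"
  assumes f: "(f has_derivative f') (at x within S)" and S: "subspace S"
    and W: "openin (top_of_set S) W" "x \<in> W" "\<And>w. w \<in> W \<Longrightarrow> f w = 0" and v: "v \<in> S"
  shows "f' v = 0"
proof -
  have xS: "x \<in> S" using W openin_imp_subset by blast
  define g where "g t = x + t *\<^sub>R v" for t :: real
  have g: "(g has_derivative (\<lambda>t. t *\<^sub>R v)) (at 0)"
    unfolding g_def by (auto intro!: derivative_eq_intros)
  have gS: "g t \<in> S" for t unfolding g_def using S xS v by (intro subspace_add subspace_scale)
  have "(f has_derivative f') (at (g 0) within range g)"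
    using has_derivative_subset[OF f, of "range g"] gS by (simp add: g_def image_subset_iff)
  from diff_chain_within[OF g this]
  have fg: "((\<lambda>t. f (g t)) has_derivative (\<lambda>t. f' (t *\<^sub>R v))) (at 0)" by (simp add: o_def)
  obtain U where U: "open U" "W = S \<inter> U" using W(1) by (auto simp: openin_open)
  have "isCont g 0" by (rule has_derivative_continuous[OF g])
  moreover have "g 0 \<in> U" using W(2) U by (simp add: g_def)
  ultimately have "\<forall>\<^sub>F t in at 0. g t \<in> U"
    using U(1) by (metis isCont_def topological_tendstoD)
  then have "\<forall>\<^sub>F t in at 0. f (g t) = 0"
    by eventually_elim (use gS W(3) U in auto)
  then have "((\<lambda>_. 0) has_derivative (\<lambda>t. f' (t *\<^sub>R v))) (at (0::real))"
    by (intro has_derivative_transform_eventually[OF fg]) (use W in \<open>auto simp: g_def\<close>)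
  from has_derivative_unique[OF this has_derivative_const] have "f' (1 *\<^sub>R v) = 0" by meson
  then show ?thesis by simp
qed

text \<open>This yields continuity of the multiplier. From l T = c follows l = c - l (T - id); once
  T is within 1/2 of the identity, the norm of l is at most twice that of c, so l (T - id) tends to
  0.\<close>

lemma blinfun_left_factor_tendsto:
  fixes l :: "'x \<Rightarrow> 'a::real_normed_vector \<Rightarrow>\<^sub>L 'b::real_normed_vector" and T :: "'x \<Rightarrow> 'a \<Rightarrow>\<^sub>L 'a"
  assumes T: "(T \<longlongrightarrow> id_blinfun) F" and c: "(c \<longlongrightarrow> c0) F"
    and eq: "\<forall>\<^sub>F x in F. l x o\<^sub>L T x = c x"
  shows "(l \<longlongrightarrow> c0) F"
proof -
  have "((\<lambda>x. norm (c x - c0) + 2 * norm (c x) * norm (T x - id_blinfun)) \<longlongrightarrow>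
      norm (c0 - c0) + 2 * norm c0 * norm (id_blinfun - id_blinfun :: 'a \<Rightarrow>\<^sub>L 'a)) F"
    by (intro tendsto_intros T c)
  then have lim: "((\<lambda>x. norm (c x - c0) + 2 * norm (c x) * norm (T x - id_blinfun)) \<longlongrightarrow> 0) F" by simp
  have "\<forall>\<^sub>F x in F. norm (l x - c0) \<le> norm (c x - c0) + 2 * norm (c x) * norm (T x - id_blinfun)"
    using eq tendstoD[OF T, of "1/2", simplified]
  proof eventually_elim
    case (elim x)
    define d where "d = norm (T x - id_blinfun)"
    have d: "0 \<le> d" "d \<le> 1/2" using elim(2) by (simp_all add: d_def dist_norm)
    define q where "q = l x o\<^sub>L (T x - id_blinfun)"
    have l: "l x = c x - q"
      unfolding elim(1)[symmetric] q_def by (intro blinfun_eqI) (simp add: blinfun.bilinear_simps)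
    have q: "norm q \<le> norm (l x) * d"
      unfolding d_def q_def by (rule norm_blinfun_compose)
    have "norm (l x) * d \<le> norm (l x) * (1/2)" using d by (intro mult_left_mono) auto
    moreover have "norm (l x) \<le> norm (c x) + norm q" unfolding l by (rule norm_triangle_ineq4)
    ultimately have "norm (l x) \<le> 2 * norm (c x)" using q by simp
    then have "norm (l x) * d \<le> 2 * norm (c x) * d" using d by (intro mult_right_mono)
    moreover have "norm (l x - c0) \<le> norm (c x - c0) + norm q"
      using norm_triangle_ineq4[of "c x - c0" q] unfolding l by (simp add: algebra_simps)
    ultimately show ?case using q by (simp add: d_def)
  qed
  from Lim_null_comparison[OF this lim] show ?thesis by (rule LIM_zero_cancel)
qed

section \<open>Functionals on a subspace and their norm\<close>

definition restrict_functional :: "'y::real_normed_vector set \<Rightarrow> ('y \<Rightarrow>\<^sub>L real) \<Rightarrow> 'y \<Rightarrow> real" where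
  "restrict_functional S f = (\<lambda>y. if y \<in> S then blinfun_apply f y else 0)"

lemma restrict_functional_dual_sp:
  assumes "subspace S"
  shows "restrict_functional S f \<in> dual_sp S"
proof -
  have "\<bar>f y\<bar> \<le> norm f * norm y" for y using norm_blinfun[of f y] by simp
  then show ?thesis using assms
    by (auto simp: dual_sp_def restrict_functional_def blinfun.add_right blinfun.scaleR_right
        subspace_add subspace_scale)
qed

lemma dual_sp_add: "f \<in> dual_sp S \<Longrightarrow> x \<in> S \<Longrightarrow> y \<in> S \<Longrightarrow> f (x + y) = f x + f y"
  and dual_sp_scale: "f \<in> dual_sp S \<Longrightarrow> x \<in> S \<Longrightarrow> f (c *\<^sub>R x) = c * f x"
  and dual_sp_outside: "f \<in> dual_sp S \<Longrightarrow> y \<notin> S \<Longrightarrow> f y = 0"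
  unfolding dual_sp_def by blast+

lemma dual_sp_bounded:
  assumes "f \<in> dual_sp S"
  obtains K where "\<And>y. y \<in> S \<Longrightarrow> \<bar>f y\<bar> \<le> K * norm y"
  using assms unfolding dual_sp_def by blast

lemma dual_sp_diff:
  assumes f: "f \<in> dual_sp S" and g: "g \<in> dual_sp S"
  shows "(\<lambda>y. f y - g y) \<in> dual_sp S"
proof -
  obtain K where K: "\<And>y. y \<in> S \<Longrightarrow> \<bar>f y\<bar> \<le> K * norm y" using dual_sp_bounded[OF f] by blast
  obtain K' where K': "\<And>y. y \<in> S \<Longrightarrow> \<bar>g y\<bar> \<le> K' * norm y" using dual_sp_bounded[OF g] by blast
  have "\<bar>f y - g y\<bar> \<le> (K + K') * norm y" if "y \<in> S" for y
    unfolding distrib_right using K[OF that] K'[OF that] by linarith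
  then have "\<exists>K. \<forall>y\<in>S. \<bar>f y - g y\<bar> \<le> K * norm y" by blast
  then show ?thesis unfolding dual_sp_def[of S]
    using dual_sp_add[OF f] dual_sp_add[OF g] dual_sp_scale[OF f] dual_sp_scale[OF g]
      dual_sp_outside[OF f] dual_sp_outside[OF g]
    by (simp add: right_diff_distrib)
qed

lemma dual_norm_le:
  assumes "0 \<in> S" "0 \<le> K" "\<And>y. y \<in> S \<Longrightarrow> \<bar>f y\<bar> \<le> K * norm y"
  shows "dual_norm S f \<le> K"
  unfolding dual_norm_def
proof (rule cSUP_least)
  show "{y \<in> S. norm y \<le> 1} \<noteq> {}" using assms(1) by auto
  fix y assume y: "y \<in> {y \<in> S. norm y \<le> 1}"
  then have "K * norm y \<le> K" using assms(2) by (simp add: mult_left_le)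
  then show "\<bar>f y\<bar> \<le> K" using assms(3)[of y] y by simp
qed

text \<open>A supremum of reals dominates its members only if they are bounded above, which the
  linear bound on f guarantees. The sign of K is left open, hence the absolute value in the
  proof.\<close>

lemma dual_norm_upper:
  assumes "\<And>y. y \<in> S \<Longrightarrow> \<bar>f y\<bar> \<le> K * norm y" "y \<in> S" "norm y \<le> 1"
  shows "\<bar>f y\<bar> \<le> dual_norm S f"
  unfolding dual_norm_def
proof (rule cSUP_upper)
  have "\<bar>f y\<bar> \<le> \<bar>K\<bar>" if "y \<in> S" "norm y \<le> 1" for y
  proof -
    have "\<bar>f y\<bar> \<le> \<bar>K\<bar> * norm y" using assms(1)[OF that(1)]
      by (meson abs_ge_self mult_right_mono norm_ge_zero order_trans)
    also have "\<dots> \<le> \<bar>K\<bar>" using that(2) by (simp add: mult_left_le)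
    finally show ?thesis .
  qed
  then show "bdd_above ((\<lambda>y. \<bar>f y\<bar>) ` {y \<in> S. norm y \<le> 1})" by (intro bdd_aboveI2) auto
qed (use assms in auto)

lemma dual_norm_nonneg:
  assumes "0 \<in> S" "\<And>y. y \<in> S \<Longrightarrow> \<bar>f y\<bar> \<le> K * norm y"
  shows "0 \<le> dual_norm S f"
proof -
  have "\<bar>f 0\<bar> \<le> dual_norm S f" by (rule dual_norm_upper[OF assms(2,1)]) simp_all
  then show ?thesis by (rule order_trans[OF abs_ge_zero])
qed

lemma dual_norm_bound:
  assumes S: "subspace S" and f: "f \<in> dual_sp S" and y: "y \<in> S"
  shows "\<bar>f y\<bar> \<le> dual_norm S f * norm y"
proof (cases "y = 0")
  case True
  have "f (0 *\<^sub>R 0) = 0 * f 0" using f subspace_0[OF S] unfolding dual_sp_def by blast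
  then show ?thesis using True by simp
next
  case False
  obtain K where K: "\<And>y. y \<in> S \<Longrightarrow> \<bar>f y\<bar> \<le> K * norm y" using f unfolding dual_sp_def by blast
  have "f ((1 / norm y) *\<^sub>R y) = (1 / norm y) * f y" using f y unfolding dual_sp_def by blast
  moreover have "\<bar>f ((1 / norm y) *\<^sub>R y)\<bar> \<le> dual_norm S f"
    using False by (intro dual_norm_upper[OF K] subspace_scale[OF S y]) auto
  moreover have "\<bar>f y\<bar> = \<bar>1 / norm y * f y\<bar> * norm y" using False by (simp add: abs_mult)
  ultimately show ?thesis by (simp only: mult_right_mono norm_ge_zero)
qed

section \<open>Restriction to the kernel of a constraint\<close>

text \<open>T is compressed to the block from \<open>V0\<close> to the dual of S and completed to an
  operator \<open>T1\<close> on the whole space by an isomorphism between the complementary blocks.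
  \<open>T1\<close> is a finite-rank perturbation of T, and its kernel, closed range and complement
  pass to the restricted block.\<close>

lemma fredholm0_dual_restrict:
  fixes T :: "'v::banach \<Rightarrow> 'y::real_normed_vector \<Rightarrow>\<^sub>L real" and D :: "'y \<Rightarrow>\<^sub>L 'e::euclidean_space"
  assumes T: "fredholm0 T" and \<iota>: "bounded_linear \<iota>" and N: "bounded_linear N"
    and right_inv: "\<And>z. D (\<iota> (N z)) = z"
    and V0: "V0 = {v. D (\<iota> v) = 0}" and S: "S = {y. D y = 0}"
  shows "fredholm0_dual V0 S (\<lambda>v. restrict_functional S (T v))"
proof -
  interpret \<iota>: bounded_linear \<iota> by fact
  interpret N: bounded_linear N by fact
  have blT: "bounded_linear T" using T by (simp add: fredholm0_def)
  interpret T: bounded_linear T by fact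
  have subS: "subspace S" unfolding S
    by (rule linear_subspace_kernel[OF bounded_linear.linear[OF blinfun.bounded_linear_right]])
  have S0: "0 \<in> S" by (rule subspace_0[OF subS])
  define \<Gamma> where "\<Gamma> v = D (\<iota> v)" for v
  have \<Gamma>: "bounded_linear \<Gamma>" unfolding \<Gamma>_def by (rule blinfun.bounded_linear_right[THEN bounded_linear_compose, OF \<iota>])
  interpret \<Gamma>: bounded_linear \<Gamma> by fact
  define J where "J = Blinfun (\<lambda>z. \<iota> (N z))"
  have J: "blinfun_apply J z = \<iota> (N z)" for z
    unfolding J_def by (simp add: bounded_linear_Blinfun_apply bounded_linear_compose[OF \<iota> N])
  \<comment> \<open>P projects V onto \<open>V0\<close> along the range of N; Q below projects Y
    onto S along the image of that range under \<iota>.\<close>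
  define P where "P v = v - N (\<Gamma> v)" for v
  have P: "bounded_linear P"
    unfolding P_def by (intro bounded_linear_sub bounded_linear_ident bounded_linear_compose[OF N \<Gamma>])
  have PV0: "P v \<in> V0" for v
    by (simp add: V0 P_def \<iota>.diff blinfun.diff_right right_inv \<Gamma>_def)
  define Q where "Q = id_blinfun - (J o\<^sub>L D)"
  have Qy: "blinfun_apply Q y = y - \<iota> (N (D y))" for y by (simp add: Q_def J blinfun.diff_left)
  have QS: "Q y \<in> S" for y by (simp add: S Qy blinfun.diff_right right_inv)
  have Qid: "Q y = y" if "y \<in> S" for y using that by (simp add: S Qy N.zero \<iota>.zero)
  \<comment> \<open>The inner product identifies the constraint space with its dual, so W maps it
    onto the functionals that vanish on S.\<close>
  define W where "W z = blinfun_inner_right z o\<^sub>L D" for z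
  have W: "bounded_linear W" unfolding W_def
    by (rule bounded_linear_compose[OF bounded_bilinear.bounded_linear_left[OF bounded_bilinear_blinfun_compose]
          bounded_linear_blinfun_inner_right])
  define T1 where "T1 v = (T (P v) o\<^sub>L Q) + W (\<Gamma> v)" for v
  have T1y: "T1 v y = T (P v) (Q y) + \<Gamma> v \<bullet> D y" for v y
    by (simp add: T1_def W_def blinfun.add_left)
  have T1S: "T1 v y = T (P v) y" if "y \<in> S" for v y using that Qid by (simp add: T1y S)
  have T1_fredholm: "fredholm0 T1"
  proof -
    \<comment> \<open>Expanding T(v - N \<Gamma> v) on y - J(D y) leaves T v plus terms that factor
      through finite-dimensional spaces.\<close>
    define K where "K v = - T (N (\<Gamma> v)) - ((T (P v) o\<^sub>L J) o\<^sub>L D) + W (\<Gamma> v)" for v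
    have c\<Gamma>: "compact_map \<Gamma>" by (rule compact_map_heine_borel[OF \<Gamma>])
    \<comment> \<open>The target is the dual of a Euclidean space, so every bounded linear map into
      it is compact.\<close>
    have "compact_map (\<lambda>v. T (P v) o\<^sub>L J)"
      by (intro compact_map_heine_borel
          bounded_bilinear.bounded_linear_left[OF bounded_bilinear_blinfun_compose, THEN bounded_linear_compose]
          bounded_linear_compose[OF blT P])
    from compact_map_compose_left[OF this bounded_bilinear.bounded_linear_left[OF bounded_bilinear_blinfun_compose]]
    have "compact_map K" unfolding K_def
      by (intro compact_map_add compact_map_diff compact_map_uminus compact_map_compose_left[OF c\<Gamma>] W
          bounded_linear_compose[OF blT N])
    moreover have "T1 = (\<lambda>v. T v + K v)"
      by (intro ext blinfun_eqI)
         (simp add: T1_def K_def Qy J P_def T.diff blinfun.bilinear_simps)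
    ultimately show ?thesis using fredholm0_add_compact[OF T, of K] by simp
  qed
  then obtain B b where blT1: "bounded_linear T1" and cl: "closed (range T1)"
    and B: "finite B" "independent B" "span B = {v. T1 v = 0}"
    and b: "\<And>c. (\<Sum>i<card B. c i *\<^sub>R b i) \<in> range T1 \<Longrightarrow> (\<forall>i<card B. c i = 0)"
    "\<And>y. \<exists>x c. y = T1 x + (\<Sum>i<card B. c i *\<^sub>R b i)"
    unfolding fredholm0_def by blast
  interpret T1: bounded_linear T1 by fact
  let ?R = "restrict_functional S"
  have R_eq: "?R f = ?R g" if "\<And>y. y \<in> S \<Longrightarrow> f y = g y" for f g :: "'y \<Rightarrow>\<^sub>L real"
    using that by (auto simp: restrict_functional_def)
  have R_apply: "?R f y = f y" if "y \<in> S" for f :: "'y \<Rightarrow>\<^sub>L real" and y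
    using that by (simp add: restrict_functional_def)
  have R_sum: "?R (f + (\<Sum>i<n. c i *\<^sub>R b i)) = (\<lambda>y. ?R f y + (\<Sum>i<n. c i * ?R (b i) y))" for f c and n :: nat
    by (rule ext) (auto simp: restrict_functional_def blinfun.bilinear_simps blinfun.sum_left)
  have RT1: "?R (T1 v) = ?R (T (P v))" for v by (rule R_eq) (rule T1S)
  have Pid: "P v = v" if "v \<in> V0" for v using that by (simp add: V0 P_def \<Gamma>_def N.zero)
  have \<Gamma>0: "\<Gamma> v = 0" if "v \<in> V0" for v using that by (simp add: V0 \<Gamma>_def)
  \<comment> \<open>Composition with Q extends a functional from S to Y and is a right inverse of
    restriction.\<close>
  define ext where "ext g = Blinfun (\<lambda>y. g (Q y))" for g :: "'y \<Rightarrow> real"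
  have ext: "ext g y = g (Q y)" if g: "g \<in> dual_sp S" for g y
  proof -
    obtain K where K: "\<And>y. y \<in> S \<Longrightarrow> \<bar>g y\<bar> \<le> K * norm y" using g unfolding dual_sp_def by blast
    have "bounded_linear (\<lambda>y. g (Q y))"
    proof (rule bounded_linear_intro)
      show "g (Q (x + y)) = g (Q x) + g (Q y)" "g (Q (c *\<^sub>R x)) = c *\<^sub>R g (Q x)" for x y c
        using dual_sp_add[OF g QS QS] dual_sp_scale[OF g QS]
        by (simp_all add: blinfun.add_right blinfun.scaleR_right)
      fix y
      have "\<bar>g (Q y)\<bar> \<le> \<bar>K\<bar> * norm (Q y)" using K[OF QS, of y]
        by (meson abs_ge_self mult_right_mono norm_ge_zero order_trans)
      also have "\<dots> \<le> \<bar>K\<bar> * (norm Q * norm y)" by (intro mult_left_mono norm_blinfun) simp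
      finally show "norm (g (Q y)) \<le> norm y * (\<bar>K\<bar> * norm Q)" by (simp add: ac_simps)
    qed
    then show ?thesis by (simp add: ext_def bounded_linear_Blinfun_apply)
  qed
  have lin: "?R (T (x + x')) = (\<lambda>y. ?R (T x) y + ?R (T x') y)" "?R (T (c *\<^sub>R x)) = (\<lambda>y. c * ?R (T x) y)" for x x' c
    by (auto simp: restrict_functional_def T.add T.scaleR blinfun.bilinear_simps)
  have bound: "\<exists>K. \<forall>x\<in>V0. dual_norm S (?R (T x)) \<le> K * norm x"
  proof -
    obtain K where K: "\<And>x. norm (T x) \<le> norm x * K" using T.bounded by blast
    have "dual_norm S (?R (T x)) \<le> norm (T x)" for x
      using norm_blinfun[of "T x"] by (intro dual_norm_le[OF S0]) (auto simp: R_apply)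
    then show ?thesis using K by (metis mult.commute order_trans)
  qed
  have closed: "g \<in> (\<lambda>v. ?R (T v)) ` V0"
    if s: "\<And>n. s n \<in> (\<lambda>v. ?R (T v)) ` V0" and g: "g \<in> dual_sp S"
      and lim: "(\<lambda>n. dual_norm S (\<lambda>y. s n y - g y)) \<longlonglongrightarrow> 0" for g s
  proof -
    have "\<exists>x. x \<in> V0 \<and> s n = ?R (T x)" for n using s[of n] by blast
    then obtain x where x: "\<And>n. x n \<in> V0" "\<And>n. s n = ?R (T (x n))" by metis
    \<comment> \<open>On \<open>V0\<close> the second block vanishes, so \<open>T1 (x n)\<close> is
      the extension of \<open>s n\<close>. Convergence in the dual norm of S therefore becomes
      operator-norm convergence, and closedness of the range of \<open>T1\<close> applies.\<close>
    have "norm (T1 (x n) - ext g) \<le> dual_norm S (\<lambda>y. s n y - g y) * norm Q" for n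
    proof -
      have mem: "(\<lambda>y. s n y - g y) \<in> dual_sp S"
        unfolding x(2) by (intro dual_sp_diff restrict_functional_dual_sp[OF subS] g)
      obtain K where "\<And>y. y \<in> S \<Longrightarrow> \<bar>s n y - g y\<bar> \<le> K * norm y" using dual_sp_bounded[OF mem] by blast
      have nn: "0 \<le> dual_norm S (\<lambda>y. s n y - g y)"
        by (rule dual_norm_nonneg[OF S0]) fact
      show ?thesis
      proof (rule norm_blinfun_bound)
        show "0 \<le> dual_norm S (\<lambda>y. s n y - g y) * norm Q" using nn by simp
        fix y
        have "norm ((T1 (x n) - ext g) y) = \<bar>s n (Q y) - g (Q y)\<bar>"
          by (simp add: blinfun.diff_left T1y ext[OF g] Pid[OF x(1)] \<Gamma>0[OF x(1)] x(2) R_apply QS)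
        also have "\<dots> \<le> dual_norm S (\<lambda>y. s n y - g y) * norm (Q y)"
          by (rule dual_norm_bound[OF subS mem QS])
        also have "\<dots> \<le> dual_norm S (\<lambda>y. s n y - g y) * (norm Q * norm y)"
          by (intro mult_left_mono norm_blinfun nn)
        finally show "norm ((T1 (x n) - ext g) y) \<le> dual_norm S (\<lambda>y. s n y - g y) * norm Q * norm y"
          by (simp add: mult.assoc)
      qed
    qed
    then have "\<forall>\<^sub>F n in sequentially. norm (T1 (x n) - ext g) \<le> dual_norm S (\<lambda>y. s n y - g y) * norm Q"
      by (intro always_eventually allI)
    from Lim_null_comparison[OF this tendsto_mult_left_zero[OF lim]]
    have "(\<lambda>n. T1 (x n) - ext g) \<longlonglongrightarrow> 0" .
    then have "(\<lambda>n. T1 (x n)) \<longlonglongrightarrow> ext g" by (rule LIM_zero_cancel)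
    then have "ext g \<in> range T1" by (rule closed_sequentially[OF cl rangeI])
    then obtain v where v: "ext g = T1 v" by blast
    have "g = ?R (T (P v))"
    proof
      fix y
      show "g y = ?R (T (P v)) y"
      proof (cases "y \<in> S")
        case True
        then have "g y = T1 v y" using ext[OF g, of y] v Qid by simp
        then show ?thesis using True T1S by (simp add: R_apply)
      next
        case False
        then show ?thesis using g by (simp add: dual_sp_def restrict_functional_def)
      qed
    qed
    then show ?thesis using PV0 by blast
  qed
  have ker: "{v. T1 v = 0} = {x \<in> V0. ?R (T x) = (\<lambda>_. 0)}"
  proof (intro set_eqI iffI)
    fix v assume "v \<in> {v. T1 v = 0}"
    then have v: "T1 v y = 0" for y by simp
    \<comment> \<open>Q annihilates the range of J while D J is the identity, so testing at this
      vector isolates the squared norm of \<Gamma> v.\<close>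
    have "T1 v (J (\<Gamma> v)) = \<Gamma> v \<bullet> \<Gamma> v"
      by (simp add: T1y J Qy right_inv blinfun.zero_right)
    then have "\<Gamma> v = 0" using v by simp
    then have "v \<in> V0" by (simp add: V0 \<Gamma>_def)
    moreover have "?R (T v) y = 0" for y
      using v[of y] T1S[of y v] Pid[OF \<open>v \<in> V0\<close>] by (simp add: restrict_functional_def)
    ultimately show "v \<in> {x \<in> V0. ?R (T x) = (\<lambda>_. 0)}" by auto
  next
    fix v assume "v \<in> {x \<in> V0. ?R (T x) = (\<lambda>_. 0)}"
    then have v: "v \<in> V0" "?R (T v) = (\<lambda>_. 0)" by auto
    have "T v y = 0" if "y \<in> S" for y using fun_cong[OF v(2), of y] that by (simp add: R_apply)
    then have "T1 v = 0" using v(1) QS by (intro blinfun_eqI) (simp add: T1y Pid \<Gamma>0)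
    then show "v \<in> {v. T1 v = 0}" by simp
  qed
  have indep: "c i = 0"
    if c: "(\<lambda>y. \<Sum>i<card B. c i * ?R (b i) y) \<in> (\<lambda>v. ?R (T v)) ` V0" and i: "i < card B" for c i
  proof -
    obtain v where v: "v \<in> V0" "(\<lambda>y. \<Sum>i<card B. c i * ?R (b i) y) = ?R (T v)" using c by blast
    define h where "h = (\<Sum>i<card B. c i *\<^sub>R b i) - T1 v"
    have hS: "h y = 0" if "y \<in> S" for y
      using fun_cong[OF v(2), of y] that T1S[OF that, of v] Pid[OF v(1)]
      by (simp add: h_def R_apply blinfun.diff_left blinfun.sum_left blinfun.scaleR_left)
    \<comment> \<open>As h vanishes on S it factors through D, and z represents the resulting
      functional on the constraint space. Since P(N z) = 0, \<open>T1 (N z)\<close> is exactly h, so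
      the combination of the b i lies in the range of \<open>T1\<close>.\<close>
    define z where "z = (\<Sum>e\<in>Basis. h (J e) *\<^sub>R e)"
    have "h = T1 (N z)"
    proof (rule blinfun_eqI)
      fix y
      have "h (Q y) = 0" by (rule hS[OF QS])
      then have "h y = h (J (D y))" by (simp add: Qy J blinfun.diff_right)
      also have "\<dots> = h (J (\<Sum>e\<in>Basis. (D y \<bullet> e) *\<^sub>R e))" by (simp add: euclidean_representation)
      also have "\<dots> = z \<bullet> D y"
        by (simp add: z_def blinfun.sum_right blinfun.scaleR_right inner_sum_left inner_sum_right inner_commute mult.commute)
      also have "\<dots> = T1 (N z) y" by (simp add: T1y P_def \<Gamma>_def right_inv T.zero)
      finally show "h y = T1 (N z) y" .
    qed
    then have "(\<Sum>i<card B. c i *\<^sub>R b i) = T1 (N z + v)" by (simp add: h_def T1.add algebra_simps)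
    then show ?thesis using b(1) i by blast
  qed
  have span: "\<exists>x\<in>V0. \<exists>c. g = (\<lambda>y. ?R (T x) y + (\<Sum>i<card B. c i * ?R (b i) y))" if g: "g \<in> dual_sp S" for g
  proof -
    obtain v c where vc: "ext g = T1 v + (\<Sum>i<card B. c i *\<^sub>R b i)" using b(2) by blast
    have "g = ?R (ext g)"
      using g by (auto simp: restrict_functional_def ext Qid dual_sp_def fun_eq_iff)
    also have "\<dots> = (\<lambda>y. ?R (T (P v)) y + (\<Sum>i<card B. c i * ?R (b i) y))" unfolding vc R_sum RT1 ..
    finally show ?thesis using PV0 by blast
  qed
  show ?thesis unfolding fredholm0_dual_def
  proof (intro conjI exI[of _ B] exI[of _ "\<lambda>i. ?R (b i)"])
    show "\<forall>x\<in>V0. \<forall>x'\<in>V0. \<forall>c. ?R (T (x + x')) = (\<lambda>y. ?R (T x) y + ?R (T x') y) \<and>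
       ?R (T (c *\<^sub>R x)) = (\<lambda>y. c * ?R (T x) y)" using lin by blast
    show "\<forall>x\<in>V0. ?R (T x) \<in> dual_sp S" "\<forall>i<card B. ?R (b i) \<in> dual_sp S"
      using restrict_functional_dual_sp[OF subS] by blast+
    show "\<exists>K. \<forall>x\<in>V0. dual_norm S (?R (T x)) \<le> K * norm x" by (rule bound)
    show "span B = {x \<in> V0. ?R (T x) = (\<lambda>_. 0)}" using B(3) ker by simp
  qed (use closed B indep span in blast)+
qed

section \<open>The reduced functional\<close>

lemma complement_right_inverse:
  fixes \<iota> :: "'v::real_normed_vector \<Rightarrow> 'y::real_normed_vector" and D :: "'y \<Rightarrow>\<^sub>L 'e::euclidean_space"
  assumes \<iota>: "bounded_linear \<iota>" and V1: "subspace V1" and bij: "bij_betw (\<lambda>v. D (\<iota> v)) V1 UNIV"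
  obtains N where "bounded_linear N" "\<And>z. N z \<in> V1" "\<And>z. D (\<iota> (N z)) = z"
    "\<And>v. v \<in> V1 \<Longrightarrow> N (D (\<iota> v)) = v"
proof -
  interpret \<iota>: bounded_linear \<iota> by fact
  define N where "N = inv_into V1 (\<lambda>v. D (\<iota> v))"
  have inj: "inj_on (\<lambda>v. D (\<iota> v)) V1" using bij by (rule bij_betw_imp_inj_on)
  have N1: "N z \<in> V1" for z
    unfolding N_def by (rule inv_into_into) (use bij in \<open>simp add: bij_betw_def\<close>)
  have N2: "D (\<iota> (N z)) = z" for z
    unfolding N_def by (rule f_inv_into_f[of z "\<lambda>v. D (\<iota> v)" V1]) (use bij in \<open>simp add: bij_betw_def\<close>)
  have N3: "N (D (\<iota> v)) = v" if "v \<in> V1" for v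
    unfolding N_def using inv_into_f_f[OF inj that] by simp
  have "linear N"
  proof (rule linearI)
    show "N (x + y) = N x + N y" for x y
      using N3[OF subspace_add[OF V1 N1[of x] N1[of y]]] by (simp add: \<iota>.add blinfun.add_right N2)
    show "N (c *\<^sub>R x) = c *\<^sub>R N x" for c x
      using N3[OF subspace_scale[OF V1 N1[of x], of c]] by (simp add: \<iota>.scaleR blinfun.scaleR_right N2)
  qed
  \<comment> \<open>Boundedness is automatic because the domain is finite-dimensional.\<close>
  then have "bounded_linear N" by (simp add: linear_conv_bounded_linear)
  then show thesis using N1 N2 N3 by (rule that)
qed

text \<open>If \<iota> v approximates y with D y = 0, subtracting N(D(\<iota> v)) moves v into the
  kernel, and the correction tends to \<iota>(N(D y)) = 0.\<close>

lemma closure_kernel_image: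
  fixes \<iota> :: "'v::real_normed_vector \<Rightarrow> 'y::real_normed_vector" and D :: "'y \<Rightarrow>\<^sub>L 'e::real_normed_vector"
  assumes \<iota>: "bounded_linear \<iota>" "closure (range \<iota>) = UNIV"
    and N: "bounded_linear N" "\<And>z. D (\<iota> (N z)) = z"
  shows "closure (\<iota> ` {v. D (\<iota> v) = 0}) = {y. D y = 0}"
proof
  interpret \<iota>: bounded_linear \<iota> by fact
  show "closure (\<iota> ` {v. D (\<iota> v) = 0}) \<subseteq> {y. D y = 0}"
    by (intro closure_minimal closed_Collect_eq continuous_intros) auto
  show "{y. D y = 0} \<subseteq> closure (\<iota> ` {v. D (\<iota> v) = 0})"
  proof
    fix y assume y: "y \<in> {y. D y = 0}"
    obtain x where x: "\<And>n. x n \<in> range \<iota>" "x \<longlonglongrightarrow> y"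
      using \<iota>(2) closure_sequential[of y "range \<iota>"] by auto
    have "\<exists>v. x n = \<iota> v" for n using x(1)[of n] by blast
    then obtain v where v: "\<And>n. x n = \<iota> (v n)" by metis
    define u where "u n = v n - N (D (\<iota> (v n)))" for n
    have "(\<lambda>n. \<iota> (u n)) \<longlonglongrightarrow> y - \<iota> (N (D y))"
      unfolding u_def \<iota>.diff v[symmetric]
      by (intro tendsto_intros x(2) \<iota>.tendsto bounded_linear.tendsto[OF N(1)])
    moreover have "\<iota> (u n) \<in> \<iota> ` {v. D (\<iota> v) = 0}" for n
      by (rule imageI) (simp add: u_def \<iota>.diff blinfun.diff_right N(2))
    moreover have "y - \<iota> (N (D y)) = y"
      using y linear_0[OF bounded_linear.linear[OF N(1)]] by (simp add: \<iota>.zero)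
    ultimately show "y \<in> closure (\<iota> ` {v. D (\<iota> v) = 0})" unfolding closure_sequential by metis
  qed
qed

theorem theorem4p3:
  fixes \<iota> :: "'v::banach \<Rightarrow> 'y::banach"
    and U :: "'v set"
    and E :: "'v \<Rightarrow> real"
    and G :: "'v \<Rightarrow> real ^ 'm::finite"
    and dE :: "'v \<Rightarrow> ('y \<Rightarrow>\<^sub>L real)"
    and dG :: "'v \<Rightarrow> ('y \<Rightarrow>\<^sub>L (real ^ 'm))"
    and E2 :: "'v \<Rightarrow> ('y \<Rightarrow>\<^sub>L real)"
    and G2 :: "'v \<Rightarrow> ('y \<Rightarrow>\<^sub>L (real ^ 'm))"
    and ubar :: 'v
    and V0 V1 \<Omega>0 \<Omega>1 \<Omega> :: "'v set"
    and \<psi> :: "'v \<Rightarrow> 'v"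
    and \<omega>bar :: 'v
  assumes U_open: "open U"
    and E_an: "analytic_sub UNIV U E"
    and G_an: "analytic_sub UNIV U G"
    and ubar_U: "ubar \<in> U"
    (* (i) continuous dense embedding *)
    and emb: "bounded_linear \<iota>" "inj \<iota>" "closure (range \<iota>) = UNIV"
    (* (ii) *)
    and dE: "\<forall>u\<in>U. (E has_derivative (\<lambda>v. blinfun_apply (dE u) (\<iota> v))) (at u)"
    and dE_an: "analytic_sub UNIV U dE"
    (* (iii) *)
    and E2: "(dE has_derivative E2) (at ubar)"
    and E2_fred: "fredholm0 E2"
    (* (iv) *)
    and dG: "\<forall>u\<in>U. (G has_derivative (\<lambda>v. blinfun_apply (dG u) (\<iota> v))) (at u)"
    and dG_an: "analytic_sub UNIV U dG"
    (* (v) *)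
    and G2: "(dG has_derivative G2) (at ubar)"
    and G2_compact: "compact_op G2"
    (* (vi) *)
    and G_ubar: "G ubar = 0"
    and G'_surj: "surj (\<lambda>v. blinfun_apply (dG ubar) (\<iota> v))"
    (* the implicit function setting *)
    and V0_def: "V0 = {v. blinfun_apply (dG ubar) (\<iota> v) = 0}"
    and V1: "subspace V1" "closed V1" "V0 \<inter> V1 = {0}" "\<forall>v. \<exists>a\<in>V0. \<exists>b\<in>V1. v = a + b"
    and \<Omega>0: "\<Omega>0 \<subseteq> V0" "openin (top_of_set V0) \<Omega>0"
    and \<Omega>1: "\<Omega>1 \<subseteq> V1" "openin (top_of_set V1) \<Omega>1"
    and \<Omega>_def: "\<Omega> = {a + b | a b. a \<in> \<Omega>0 \<and> b \<in> \<Omega>1}"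
    and ubar_\<Omega>: "ubar \<in> \<Omega>" and \<Omega>_U: "\<Omega> \<subseteq> U"
    and \<psi>_an: "analytic_sub V0 \<Omega>0 \<psi>"
    and \<psi>_range: "\<psi> ` \<Omega>0 \<subseteq> \<Omega>1"
    and zeros: "{u\<in>\<Omega>. G u = 0} = {\<omega> + \<psi> \<omega> | \<omega>. \<omega> \<in> \<Omega>0}"
    and iso: "\<forall>u\<in>\<Omega>. bij_betw (\<lambda>v. blinfun_apply (dG u) (\<iota> v)) V1 UNIV"
    and \<omega>bar: "\<omega>bar \<in> \<Omega>0" "\<omega>bar + \<psi> \<omega>bar = ubar"
  shows "\<exists>Fd :: 'v \<Rightarrow> 'y \<Rightarrow> real.
           (\<forall>\<omega>\<in>\<Omega>0. Fd \<omega> \<in> dual_sp (closure (\<iota> ` V0)) \<and>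
              (\<exists>L. ((\<lambda>w. E (w + \<psi> w)) has_derivative L) (at \<omega> within V0) \<and>
                   (\<forall>v\<in>V0. L v = Fd \<omega> (\<iota> v)))) \<and>
           (\<exists>F2 :: 'v \<Rightarrow> 'y \<Rightarrow> real.
              ((\<lambda>h. dual_norm (closure (\<iota> ` V0))
                       (\<lambda>y. Fd (\<omega>bar + h) y - Fd \<omega>bar y - F2 h y) / norm h) \<longlongrightarrow> 0)
                (at 0 within V0) \<and>
              fredholm0_dual V0 (closure (\<iota> ` V0)) F2)"
proof -
  interpret \<iota>: bounded_linear \<iota> by fact
  define S where "S = closure (\<iota> ` V0)"
  define \<phi> where "\<phi> \<omega> = \<omega> + \<psi> \<omega>" for \<omega>
  have \<phi>\<Omega>: "\<phi> \<omega> \<in> \<Omega>" and \<phi>U: "\<phi> \<omega> \<in> U" and G\<phi>: "G (\<phi> \<omega>) = 0" if "\<omega> \<in> \<Omega>0" for \<omega>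
    using that zeros \<Omega>_U unfolding \<phi>_def by blast+
  have \<phi>bar: "\<phi> \<omega>bar = ubar" using \<omega>bar by (simp add: \<phi>_def)
  have bij: "bij_betw (\<lambda>v. dG u (\<iota> v)) V1 UNIV" if "u \<in> \<Omega>" for u using iso that by blast
  obtain N where N: "bounded_linear N" "\<And>z. N z \<in> V1" "\<And>z. dG ubar (\<iota> (N z)) = z"
    "\<And>v. v \<in> V1 \<Longrightarrow> N (dG ubar (\<iota> v)) = v"
    using complement_right_inverse[OF emb(1) V1(1) bij[OF ubar_\<Omega>]] by metis
  interpret N: bounded_linear N by fact
  have bl\<Gamma>: "bounded_linear (\<lambda>v. dG ubar (\<iota> v))"
    by (rule bounded_linear_compose[OF blinfun.bounded_linear_right emb(1)])
  have V0: "subspace V0" unfolding V0_def by (rule linear_subspace_kernel[OF bounded_linear.linear[OF bl\<Gamma>]])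
  have S: "S = {y. dG ubar y = 0}"
    unfolding S_def V0_def by (rule closure_kernel_image[OF emb(1,3) N(1,3)])
  have subS: "subspace S" unfolding S
    by (rule linear_subspace_kernel[OF bounded_linear.linear[OF blinfun.bounded_linear_right]])
  have S0: "0 \<in> S" by (rule subspace_0[OF subS])
  \<comment> \<open>The projection onto \<open>V0\<close> along \<open>V1\<close>, whose kernel is
    exactly \<open>V1\<close>.\<close>
  define P where "P v = v - N (dG ubar (\<iota> v))" for v
  have P: "bounded_linear P"
    unfolding P_def by (intro bounded_linear_sub bounded_linear_ident bounded_linear_compose[OF N(1) bl\<Gamma>])
  have PV0: "P v \<in> V0" for v by (simp add: V0_def P_def \<iota>.diff blinfun.diff_right N(3))
  have Pid: "P v = v" if "v \<in> V0" for v using that by (simp add: V0_def P_def N.zero)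
  have PV1: "P v = 0" if "v \<in> V1" for v using that by (simp add: P_def N(4))
  have PV1': "v \<in> V1" if "P v = 0" for v using that N(2)[of "dG ubar (\<iota> v)"] by (simp add: P_def)
  \<comment> \<open>The Lagrange multiplier, determined by the equation on \<open>V1\<close>.\<close>
  have "\<exists>l. \<forall>v\<in>V1. blinfun_apply l (dG u (\<iota> v)) = dE u (\<iota> v)" if u: "u \<in> \<Omega>" for u
  proof -
    obtain M where M: "bounded_linear M" "\<And>v. v \<in> V1 \<Longrightarrow> M (dG u (\<iota> v)) = v"
      using complement_right_inverse[OF emb(1) V1(1) bij[OF u]] by metis
    have "bounded_linear (\<lambda>z. dE u (\<iota> (M z)))"
      by (intro bounded_linear_compose[OF blinfun.bounded_linear_right] bounded_linear_compose[OF emb(1)] M(1))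
    then have "blinfun_apply (Blinfun (\<lambda>z. dE u (\<iota> (M z)))) z = dE u (\<iota> (M z))" for z
      by (simp add: bounded_linear_Blinfun_apply)
    then show ?thesis using M(2) by metis
  qed
  then obtain l where l: "\<And>u v. u \<in> \<Omega> \<Longrightarrow> v \<in> V1 \<Longrightarrow> blinfun_apply (l u) (dG u (\<iota> v)) = dE u (\<iota> v)"
    by metis
  \<comment> \<open>By the choice of l this functional vanishes on the image of \<open>V1\<close>,
    so the component of a tangent vector in \<open>V1\<close> does not contribute to it.\<close>
  define \<Lambda> where "\<Lambda> \<omega> = dE (\<phi> \<omega>) - (l (\<phi> \<omega>) o\<^sub>L dG (\<phi> \<omega>))" for \<omega>
  define Fd where "Fd \<omega> = restrict_functional S (\<Lambda> \<omega>)" for \<omega>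
  \<comment> \<open>The second derivative of the Lagrangian, with the multiplier frozen at
    \<open>ubar\<close>.\<close>
  define T where "T v = E2 v - (l ubar o\<^sub>L G2 v)" for v
  define F2 where "F2 v = restrict_functional S (T v)" for v
  \<comment> \<open>Differentiating P(\<psi>) = 0 places the derivative of \<psi> in
    \<open>V1\<close>; differentiating G(\<phi>) = 0 makes v + \<psi>' v tangent to the
    constraint.\<close>
  have \<phi>_deriv: "\<exists>\<psi>'. (\<phi> has_derivative (\<lambda>v. v + \<psi>' v)) (at \<omega> within V0) \<and>
      (\<forall>v\<in>V0. \<psi>' v \<in> V1 \<and> dG (\<phi> \<omega>) (\<iota> (v + \<psi>' v)) = 0)" if \<omega>: "\<omega> \<in> \<Omega>0" for \<omega>
  proof -
    have "\<omega> \<in> V0" using \<omega> \<Omega>0 by blast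
    then obtain \<psi>' where \<psi>': "(\<psi> has_derivative \<psi>') (at \<omega> within V0)"
      using analytic_sub_has_derivative[OF \<psi>_an V0 \<omega> _ P PV0 Pid] by blast
    then have \<phi>': "(\<phi> has_derivative (\<lambda>v. v + \<psi>' v)) (at \<omega> within V0)"
      unfolding \<phi>_def by (intro has_derivative_add has_derivative_ident)
    have "((\<lambda>w. P (\<psi> w)) has_derivative (\<lambda>v. P (\<psi>' v))) (at \<omega> within V0)"
      by (rule bounded_linear.has_derivative[OF P \<psi>'])
    then have "P (\<psi>' v) = 0" if "v \<in> V0" for v
      using derivative_vanishes[OF _ V0 \<Omega>0(2) \<omega> _ that] PV1 \<psi>_range \<Omega>1(1) by blast
    then have 1: "\<psi>' v \<in> V1" if "v \<in> V0" for v using that PV1' by blast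
    have "(G has_derivative (\<lambda>v. dG (\<phi> \<omega>) (\<iota> v))) (at (\<phi> \<omega>) within \<phi> ` V0)"
      using dG \<phi>U[OF \<omega>] by (blast intro: has_derivative_at_withinI)
    from diff_chain_within[OF \<phi>' this]
    have "((\<lambda>w. G (\<phi> w)) has_derivative (\<lambda>v. dG (\<phi> \<omega>) (\<iota> (v + \<psi>' v)))) (at \<omega> within V0)"
      by (simp add: o_def)
    from derivative_vanishes[OF this V0 \<Omega>0(2) \<omega> G\<phi>]
    show ?thesis using \<phi>' 1 by blast
  qed
  have first: "Fd \<omega> \<in> dual_sp S \<and> (\<exists>L. ((\<lambda>w. E (w + \<psi> w)) has_derivative L) (at \<omega> within V0) \<and>
      (\<forall>v\<in>V0. L v = Fd \<omega> (\<iota> v)))" if \<omega>: "\<omega> \<in> \<Omega>0" for \<omega>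
  proof (intro conjI)
    show "Fd \<omega> \<in> dual_sp S" unfolding Fd_def by (rule restrict_functional_dual_sp[OF subS])
    obtain \<psi>' where \<phi>': "(\<phi> has_derivative (\<lambda>v. v + \<psi>' v)) (at \<omega> within V0)"
      and \<psi>': "\<And>v. v \<in> V0 \<Longrightarrow> \<psi>' v \<in> V1" "\<And>v. v \<in> V0 \<Longrightarrow> dG (\<phi> \<omega>) (\<iota> (v + \<psi>' v)) = 0"
      using \<phi>_deriv[OF \<omega>] by blast
    have "(E has_derivative (\<lambda>v. dE (\<phi> \<omega>) (\<iota> v))) (at (\<phi> \<omega>) within \<phi> ` V0)"
      using dE \<phi>U[OF \<omega>] by (blast intro: has_derivative_at_withinI)
    from diff_chain_within[OF \<phi>' this]
    have "((\<lambda>w. E (w + \<psi> w)) has_derivative (\<lambda>v. dE (\<phi> \<omega>) (\<iota> (v + \<psi>' v)))) (at \<omega> within V0)"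
      by (simp add: o_def \<phi>_def)
    moreover have "dE (\<phi> \<omega>) (\<iota> (v + \<psi>' v)) = Fd \<omega> (\<iota> v)" if v: "v \<in> V0" for v
    proof -
      have "\<iota> v \<in> S" using v by (simp add: S V0_def)
      then have "Fd \<omega> (\<iota> v) = dE (\<phi> \<omega>) (\<iota> v) - l (\<phi> \<omega>) (dG (\<phi> \<omega>) (\<iota> v))"
        by (simp add: Fd_def restrict_functional_def \<Lambda>_def blinfun.diff_left)
      \<comment> \<open>Tangency moves the multiplier term from v to \<psi>' v, where the multiplier
        equation on \<open>V1\<close> turns it into the missing value of dE.\<close>
      moreover have "dG (\<phi> \<omega>) (\<iota> v) = - dG (\<phi> \<omega>) (\<iota> (\<psi>' v))"
        using \<psi>'(2)[OF v] by (simp add: \<iota>.add blinfun.add_right eq_neg_iff_add_eq_0)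
      ultimately show ?thesis
        using l[OF \<phi>\<Omega>[OF \<omega>] \<psi>'(1)[OF v]] by (simp add: \<iota>.add blinfun.add_right blinfun.minus_right)
    qed
    ultimately show "\<exists>L. ((\<lambda>w. E (w + \<psi> w)) has_derivative L) (at \<omega> within V0) \<and>
      (\<forall>v\<in>V0. L v = Fd \<omega> (\<iota> v))" by blast
  qed
  obtain \<phi>' where \<phi>'d: "(\<phi> has_derivative \<phi>') (at \<omega>bar within V0)" and \<phi>'id: "\<And>v. v \<in> V0 \<Longrightarrow> \<phi>' v = v"
  proof -
    obtain \<psi>' where \<phi>': "(\<phi> has_derivative (\<lambda>v. v + \<psi>' v)) (at \<omega>bar within V0)"
      and \<psi>': "\<And>v. v \<in> V0 \<Longrightarrow> \<psi>' v \<in> V1" "\<And>v. v \<in> V0 \<Longrightarrow> dG ubar (\<iota> (v + \<psi>' v)) = 0"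
      using \<phi>_deriv[OF \<omega>bar(1)] unfolding \<phi>bar by blast
    \<comment> \<open>At the base point tangency means v + \<psi>' v lies in \<open>V0\<close>;
      hence \<psi>' v lies in both \<open>V0\<close> and \<open>V1\<close>.\<close>
    have "\<psi>' v = 0" if v: "v \<in> V0" for v
    proof -
      have "v + \<psi>' v \<in> V0" using \<psi>'(2)[OF v] by (simp add: V0_def)
      from subspace_diff[OF V0 this v] have "\<psi>' v \<in> V0 \<inter> V1" using \<psi>'(1)[OF v] by simp
      then show ?thesis using V1(3) by blast
    qed
    then show thesis using that[OF \<phi>'] by simp
  qed
  have dE\<phi>: "((\<lambda>w. dE (\<phi> w)) has_derivative (\<lambda>v. E2 (\<phi>' v))) (at \<omega>bar within V0)"
    and dG\<phi>: "((\<lambda>w. dG (\<phi> w)) has_derivative (\<lambda>v. G2 (\<phi>' v))) (at \<omega>bar within V0)"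
    using diff_chain_within[OF \<phi>'d, of dE E2] diff_chain_within[OF \<phi>'d, of dG G2] E2 G2
    by (simp_all add: \<phi>bar has_derivative_at_withinI o_def)
  have ev: "\<forall>\<^sub>F w in at \<omega>bar within V0. w \<in> \<Omega>0"
  proof -
    obtain X where "open X" "\<Omega>0 = V0 \<inter> X" using \<Omega>0(2) by (auto simp: openin_open)
    then show ?thesis using \<omega>bar(1) unfolding eventually_at_topological by blast
  qed
  have E_cont: "((\<lambda>w. dE (\<phi> w)) \<longlongrightarrow> dE ubar) (at \<omega>bar within V0)"
    and G_cont: "((\<lambda>w. dG (\<phi> w)) \<longlongrightarrow> dG ubar) (at \<omega>bar within V0)"
    using has_derivative_continuous[OF dE\<phi>] has_derivative_continuous[OF dG\<phi>]
    by (simp_all add: continuous_within \<phi>bar)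
  have l_cont: "((\<lambda>w. l (\<phi> w)) \<longlongrightarrow> l ubar) (at \<omega>bar within V0)"
  proof -
    \<comment> \<open>Along J the multiplier equation reads l(u) (dG(u) J) = dE(u) J, and dG(u) J
      tends to the identity along u = \<phi>(w).\<close>
    define J where "J = Blinfun (\<lambda>z. \<iota> (N z))"
    have J: "blinfun_apply J z = \<iota> (N z)" for z
      unfolding J_def by (simp add: bounded_linear_Blinfun_apply bounded_linear_compose[OF emb(1) N(1)])
    have lJ: "l u o\<^sub>L (dG u o\<^sub>L J) = dE u o\<^sub>L J" if "u \<in> \<Omega>" for u
      using l[OF that N(2)] by (intro blinfun_eqI) (simp add: J)
    have id: "dG ubar o\<^sub>L J = id_blinfun" by (intro blinfun_eqI) (simp add: J N(3))
    have T: "((\<lambda>w. dG (\<phi> w) o\<^sub>L J) \<longlongrightarrow> id_blinfun) (at \<omega>bar within V0)"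
      unfolding id[symmetric] by (rule bounded_bilinear.tendsto[OF bounded_bilinear_blinfun_compose G_cont tendsto_const])
    have c: "((\<lambda>w. dE (\<phi> w) o\<^sub>L J) \<longlongrightarrow> dE ubar o\<^sub>L J) (at \<omega>bar within V0)"
      by (rule bounded_bilinear.tendsto[OF bounded_bilinear_blinfun_compose E_cont tendsto_const])
    have eq: "\<forall>\<^sub>F w in at \<omega>bar within V0. l (\<phi> w) o\<^sub>L (dG (\<phi> w) o\<^sub>L J) = dE (\<phi> w) o\<^sub>L J"
      using ev by eventually_elim (rule lJ[OF \<phi>\<Omega>])
    have "dE ubar o\<^sub>L J = l ubar"
    proof -
      have "l ubar o\<^sub>L id_blinfun = l ubar" by (intro blinfun_eqI) simp
      then show ?thesis using lJ[OF ubar_\<Omega>] by (simp add: id)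
    qed
    with blinfun_left_factor_tendsto[OF T c eq] show ?thesis by simp
  qed
  have blG2: "bounded_linear G2" using G2 by (rule has_derivative_bounded_linear)
  have second: "((\<lambda>h. dual_norm S (\<lambda>y. Fd (\<omega>bar + h) y - Fd \<omega>bar y - F2 h y) / norm h) \<longlongrightarrow> 0) (at 0 within V0)"
  proof -
    define rE where "rE w = norm (dE (\<phi> w) - dE ubar - E2 (\<phi>' (w - \<omega>bar))) / norm (w - \<omega>bar)" for w
    define rG where "rG w = norm (dG (\<phi> w) - dG ubar - G2 (\<phi>' (w - \<omega>bar))) / norm (w - \<omega>bar)" for w
    \<comment> \<open>The last summand is where continuity of l enters: its increment tends to 0 and
      multiplies a bounded bound for the difference quotient of dG.\<close>
    define q where "q w = rE w + norm (l ubar) * rG w + norm (l (\<phi> w) - l ubar) * (rG w + onorm G2)" for w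
    have "(rE \<longlongrightarrow> 0) (at \<omega>bar within V0)" "(rG \<longlongrightarrow> 0) (at \<omega>bar within V0)"
      using dE\<phi> dG\<phi> unfolding rE_def[abs_def] rG_def[abs_def] has_derivative_iff_norm \<phi>bar by simp_all
    then have "(q \<longlongrightarrow> 0 + norm (l ubar) * 0 + norm (l ubar - l ubar) * (0 + onorm G2)) (at \<omega>bar within V0)"
      unfolding q_def[abs_def] by (intro tendsto_intros l_cont)
    then have q: "(q \<longlongrightarrow> 0) (at \<omega>bar within V0)" by simp
    have \<omega>barV0: "\<omega>bar \<in> V0" using \<omega>bar \<Omega>0 by blast
    have shift: "filterlim (\<lambda>h. \<omega>bar + h) (at \<omega>bar within V0) (at 0 within V0)"
      unfolding filterlim_at
    proof
      show "\<forall>\<^sub>F h in at 0 within V0. \<omega>bar + h \<in> V0 \<and> \<omega>bar + h \<noteq> \<omega>bar"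
        using subspace_add[OF V0 \<omega>barV0] by (auto simp: eventually_at_filter)
      have "((\<lambda>h. \<omega>bar + h) \<longlongrightarrow> \<omega>bar + 0) (at 0 within V0)" by (intro tendsto_intros)
      then show "((\<lambda>h. \<omega>bar + h) \<longlongrightarrow> \<omega>bar) (at 0 within V0)" by simp
    qed
    have lim: "((\<lambda>h. q (\<omega>bar + h)) \<longlongrightarrow> 0) (at 0 within V0)" by (rule filterlim_compose[OF q shift])
    have "\<forall>\<^sub>F h in at 0 within V0. \<omega>bar + h \<in> \<Omega>0" by (rule eventually_compose_filterlim[OF ev shift])
    moreover have "\<forall>\<^sub>F h in at 0 within V0. h \<in> V0 \<and> h \<noteq> 0" by (simp add: eventually_at_filter)
    ultimately have "\<forall>\<^sub>F h in at 0 within V0.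
        norm (dual_norm S (\<lambda>y. Fd (\<omega>bar + h) y - Fd \<omega>bar y - F2 h y) / norm h) \<le> q (\<omega>bar + h)"
    proof eventually_elim
      case (elim h)
      define w where "w = \<omega>bar + h"
      have h: "h \<in> V0" "0 < norm h" "w \<in> \<Omega>0" "\<phi>' (w - \<omega>bar) = h" "w - \<omega>bar = h"
        using elim \<phi>'id by (auto simp: w_def)
      define a where "a = dE (\<phi> w) - dE ubar - E2 h"
      define b where "b = dG (\<phi> w) - dG ubar - G2 h"
      define d where "d = l (\<phi> w) - l ubar"
      have a: "norm a = rE w * norm h" and b: "norm b = rG w * norm h"
        using h by (simp_all add: rE_def rG_def a_def b_def)
      have Gd: "norm (dG (\<phi> w) - dG ubar) \<le> (rG w + onorm G2) * norm h"
      proof -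
        have "norm (dG (\<phi> w) - dG ubar) \<le> norm b + norm (G2 h)"
          using norm_triangle_ineq[of b "G2 h"] by (simp add: b_def)
        then show ?thesis using onorm[OF blG2, of h] b by (simp add: distrib_right)
      qed
      let ?f = "\<lambda>y. Fd w y - Fd \<omega>bar y - F2 h y"
      have K: "\<bar>?f y\<bar> \<le> (q w * norm h) * norm y" if y: "y \<in> S" for y
      proof -
        have y0: "dG ubar y = 0" using y by (simp add: S)
        have "?f y = a y - l ubar (b y) - d ((dG (\<phi> w) - dG ubar) y)"
          using y y0 by (simp add: Fd_def F2_def restrict_functional_def \<Lambda>_def T_def a_def b_def d_def
              \<phi>bar blinfun.bilinear_simps)
        then have "\<bar>?f y\<bar> \<le> \<bar>a y\<bar> + \<bar>l ubar (b y)\<bar> + \<bar>d ((dG (\<phi> w) - dG ubar) y)\<bar>" by linarith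
        also have "\<dots> \<le> norm a * norm y + norm (l ubar) * (norm b * norm y)
            + norm d * (norm (dG (\<phi> w) - dG ubar) * norm y)"
          by (intro add_mono order_trans[OF norm_blinfun[of "l ubar", simplified real_norm_def]]
              order_trans[OF norm_blinfun[of d, simplified real_norm_def]] mult_left_mono norm_blinfun
              norm_blinfun[of a, simplified real_norm_def] norm_ge_zero)
        also have "\<dots> \<le> norm a * norm y + norm (l ubar) * (norm b * norm y)
            + norm d * (((rG w + onorm G2) * norm h) * norm y)"
          by (intro add_left_mono mult_left_mono mult_right_mono Gd norm_ge_zero)
        also have "\<dots> = (q w * norm h) * norm y"
          by (simp add: a b q_def d_def algebra_simps)
        finally show ?thesis .
      qed
      have "0 \<le> q w"
      proof -
        have "0 \<le> rE w" "0 \<le> rG w" by (simp_all add: rE_def rG_def)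
        then show ?thesis using onorm_pos_le[OF blG2] by (simp add: q_def)
      qed
      then have "dual_norm S ?f \<le> q w * norm h" by (intro dual_norm_le[OF S0] K) auto
      moreover have "0 \<le> dual_norm S ?f" by (rule dual_norm_nonneg[OF S0 K])
      ultimately show ?case using h(2) unfolding w_def by (simp add: divide_le_eq)
    qed
    then show ?thesis by (rule Lim_null_comparison[OF _ lim])
  qed
  have third: "fredholm0_dual V0 S F2"
  proof -
    have "compact_map (\<lambda>v. - (l ubar o\<^sub>L G2 v))"
      by (intro compact_map_uminus compact_map_compose_left[OF compact_op_imp_compact_map[OF G2_compact]]
          bounded_bilinear.bounded_linear_right[OF bounded_bilinear_blinfun_compose])
    from fredholm0_add_compact[OF E2_fred this] have "fredholm0 T" by (simp add: T_def[abs_def])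
    then show ?thesis unfolding F2_def
      by (rule fredholm0_dual_restrict[OF _ emb(1) N(1,3) V0_def S])
  qed
  show ?thesis unfolding S_def[symmetric]
    using first second third by (intro exI[of _ Fd] exI[of _ F2] conjI ballI) auto
qed

end
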